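(* Let $d\ge 2$ and let $\hat H$ be the $S=\frac12$ nearest-neighbor Hamiltonian on the periodic hypercubic lattice $\Lambda=\{1,\dots,L\}^d$ with parameters $J_{\mathrm X},J_{\mathrm Y},J_{\mathrm Z},h_{\mathrm X},h_{\mathrm Y},h_{\mathrm Z}\in\mathbb R$ satisfying $J_{\mathrm X}\neq 0$ and $J_{\mathrm Y}\ne 0$. Let $k_{\max}$ be an integer with $2\le k_{\max}\le L/2$ and let $$\hat Q=\sum_{\boldsymbol{\hat A}\in\mathcal P_\Lambda,\ \operatorname{Wid}\boldsymbol{\hat A}\le k_{\max}} q_{\boldsymbol{\hat A}}\,\boldsymbol{\hat A},\qquad q_{\boldsymbol{\hat A}}\in\mathbb C,$$ with $q_{\boldsymbol{\hat A}}\neq 0$ for at least one $\boldsymbol{\hat A}$ with $\operatorname{Wid}\boldsymbol{\hat A}=k_{\max}$. Then $\hat Q$ does not satisfy $[\hat H,\hat Q]=\mu\,\hat Q$ for any $\mu\in\mathbb R\setminus\{0\}$.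
   Context: $\Lambda=\{1,\dots,L\}^d$ is the $d$-dimensional hypercubic lattice with periodic boundary conditions (coordinates mod $L$). For $u,v\in\Lambda$, $|u-v|=1$ means that $u,v$ are nearest neighbors, i.e. they differ by $\pm1$ (mod $L$) in exactly one coordinate and agree in the others. Each site carries a copy of $\mathbb C^2$; $\hat X_u,\hat Y_u,\hat Z_u,\hat I_u$ are the Pauli matrices and the identity acting at site $u$ (tensored with the identity elsewhere). The Hamiltonian is $$\hat H=-\frac12\sum_{u,v\in\Lambda,\ |u-v|=1}\{J_{\mathrm X}\hat X_u\hat X_v+J_{\mathrm Y}\hat Y_u\hat Y_v+J_{\mathrm Z}\hat Z_u\hat Z_v\}-\sum_{u\in\Lambda}\{h_{\mathrm X}\hat X_u+h_{\mathrm Y}\hat Y_u+h_{\mathrm Z}\hat Z_u\},$$ the first sum being over ordered pairs. A product (of Pauli matrices) is an operator $\boldsymbol{\hat A}=\bigotimes_{u\in S}\hat A_u$ (tensored with the identity on $\Lambda\setminus S$) with $S\subset\Lambda$ nonempty and $\hat A_u\in\{\hat X_u,\hat Y_u,\hat Z_u\}$; $\operatorname{Supp}\boldsymbol{\hat A}=S$. $\mathcal P_\Lambda$ is the set of all products. For nonempty $S\subset\Lambda$ and $\alpha\in\{1,\dots,d\}$, $\operatorname{Wid}_\alpha S$ is the minimum $k$ for which there is $a\in\{1,\dots,L\}$ such that for every $u\in S$ the residue mod $L$ of $(u)_\alpha-a$ lies in $\{0,\dots,k-1\}$, where $(u)_\alpha$ is the $\alpha$-th coordinate. $\operatorname{Wid}S=\max_\alpha\operatorname{Wid}_\alpha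 S$ and $\operatorname{Wid}\boldsymbol{\hat A}=\operatorname{Wid}\operatorname{Supp}\boldsymbol{\hat A}$. *)

theory Defs
  imports "HOL-Analysis.Analysis" "Berlekamp_Zassenhaus.Finite_Field"
begin

text \<open>
  The periodic lattice with side length \<open>L = CARD('l)\<close> in dimension \<open>d = CARD('d)\<close> is
  \<open>(\<int>/L\<int>)\<^sup>d\<close>, so that coordinate differences are automatically taken mod \<open>L\<close>.
  The class \<open>nontriv\<close> only says \<open>L > 1\<close>.
\<close>

type_synonym ('l, 'd) site = "'l mod_ring ^ 'd"

definition nearest_neighbours ::
    "('l::nontriv, 'd::finite) site \<Rightarrow> ('l, 'd) site \<Rightarrow> bool" where
  "nearest_neighbours u v \<longleftrightarrow>
     (\<exists>\<alpha>. (u $ \<alpha> - v $ \<alpha> = 1 \<or> u $ \<alpha> - v $ \<alpha> = -1) \<and> (\<forall>\<beta>. \<beta> \<noteq> \<alpha> \<longrightarrow> u $ \<beta> = v $ \<beta>))"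

text \<open>
  The tensor product of copies of \<open>\<complex>\<^sup>2\<close> over the sites \<open>'v\<close> has the standard basis indexed by
  the configurations \<open>'v \<Rightarrow> 2\<close>; operators are given by their matrices in this basis.
\<close>

type_synonym 'v operator = "complex ^ ('v \<Rightarrow> 2) ^ ('v \<Rightarrow> 2)"

definition cscale :: "complex \<Rightarrow> 'v::finite operator \<Rightarrow> 'v operator" where
  "cscale c A = (\<chi> s t. c * A $ s $ t)"

definition commutator :: "'v::finite operator \<Rightarrow> 'v operator \<Rightarrow> 'v operator" where
  "commutator A B = A ** B - B ** A"

datatype pauli = PX | PY | PZ

fun pauli_matrix :: "pauli \<Rightarrow> complex ^ 2 ^ 2" where
  "pauli_matrix PX = vector [vector [0, 1], vector [1, 0]]"
| "pauli_matrix PY = vector [vector [0, - \<i>], vector [\<i>, 0]]"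
| "pauli_matrix PZ = vector [vector [1, 0], vector [0, -1]]"

fun site_matrix :: "pauli option \<Rightarrow> complex ^ 2 ^ 2" where
  "site_matrix None = mat 1"
| "site_matrix (Some P) = pauli_matrix P"

text \<open>
  A product of Pauli matrices is encoded by the partial map sending each site of its support to
  the Pauli matrix placed there. Different maps give different (indeed linearly independent)
  operators, so coefficients may be indexed by the maps. The operator has the matrix entries
  of the tensor product over all sites, with the identity outside the support.
\<close>

definition products :: "('v \<rightharpoonup> pauli) set" where
  "products = {A. dom A \<noteq> {}}"

definition product_op :: "('v::finite \<rightharpoonup> pauli) \<Rightarrow> 'v operator" where
  "product_op A = (\<chi> s t. \<Prod>u\<in>UNIV. site_matrix (A u) $ s u $ t u)"

definition site_op :: "pauli \<Rightarrow> 'v::finite \<Rightarrow> 'v operator" where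
  "site_op P u = product_op [u \<mapsto> P]"

definition hamiltonian ::
    "real \<Rightarrow> real \<Rightarrow> real \<Rightarrow> real \<Rightarrow> real \<Rightarrow> real \<Rightarrow> ('l::nontriv, 'd::finite) site operator" where
  "hamiltonian J\<^sub>X J\<^sub>Y J\<^sub>Z h\<^sub>X h\<^sub>Y h\<^sub>Z =
     - (1/2) *\<^sub>R (\<Sum>(u, v)\<in>{(u, v). nearest_neighbours u v}.
         J\<^sub>X *\<^sub>R (site_op PX u ** site_op PX v)
       + J\<^sub>Y *\<^sub>R (site_op PY u ** site_op PY v)
       + J\<^sub>Z *\<^sub>R (site_op PZ u ** site_op PZ v))
     - (\<Sum>u\<in>UNIV. h\<^sub>X *\<^sub>R site_op PX u + h\<^sub>Y *\<^sub>R site_op PY u + h\<^sub>Z *\<^sub>R site_op PZ u)"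

text \<open>\<open>to_int_mod_ring\<close> yields the representative in \<open>{0..<L}\<close>.\<close>

definition coord_width :: "'d::finite \<Rightarrow> ('l::nontriv, 'd) site set \<Rightarrow> nat" where
  "coord_width \<alpha> S =
     (LEAST k. \<exists>a. \<forall>u\<in>S. to_int_mod_ring (u $ \<alpha> - a) \<in> {0..<int k})"

definition width :: "('l::nontriv, 'd::finite) site set \<Rightarrow> nat" where
  "width S = Max (range (\<lambda>\<alpha>. coord_width \<alpha> S))"

end

theory Submission
  imports Defs
begin

text \<open>
  Compare the coefficients of the products in \<open>[H, Q] = \<mu> Q\<close>. At width \<open>k + 1\<close> the right-hand side
  has none, so a product of width \<open>k\<close> that occurs in \<open>Q\<close> may be moved along its long axis by
  appending a bond in front and removing one behind. Repeating this shows that its support is a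
  straight segment and brings it to the form \<open>c Z \<dots> Z c'\<close> with \<open>c, c' \<in> {X, Y}\<close>; the coefficients of
  such a string and its translate are nonzero multiples of each other.

  If the string is not, up to a phase, a product of bonds (improper parity), attach a bond sideways in
  a second lattice direction: the equations for the T-shaped products telescope as the string slides
  past the attached bond and give \<open>k - 2\<close> times its coefficient equal to \<open>0\<close>. For \<open>k = 2\<close> the
  coefficient changes sign when one neighbour of a site is replaced by another, and there are at
  least three neighbours.

  If the string is a product of bonds (proper parity), its own equation at width \<open>k\<close> involves, besides
  \<open>\<mu>\<close> times its coefficient, only the two strings of length \<open>k - 1\<close> obtained by cutting off one end,
  with opposite signs after normalisation. Summed along a closed loop around the torus these cancel,
  so \<open>\<mu>\<close> times the coefficient vanishes.
\<close>

section \<open>The algebra of products of Pauli matrices\<close>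

text \<open>This is the Klein four-group of Pauli matrices modulo phases, with \<open>None\<close>
  as unit. The scalars are split off into \<open>phase\<close>, so that letters and supports can be
  computed without them.\<close>

fun pmul :: "pauli option \<Rightarrow> pauli option \<Rightarrow> pauli option" where
  "pmul None b = b"
| "pmul a None = a"
| "pmul (Some PX) (Some PX) = None"
| "pmul (Some PX) (Some PY) = Some PZ"
| "pmul (Some PX) (Some PZ) = Some PY"
| "pmul (Some PY) (Some PX) = Some PZ"
| "pmul (Some PY) (Some PY) = None"
| "pmul (Some PY) (Some PZ) = Some PX"
| "pmul (Some PZ) (Some PX) = Some PY"
| "pmul (Some PZ) (Some PY) = Some PX"
| "pmul (Some PZ) (Some PZ) = None"

fun phase :: "pauli option \<Rightarrow> pauli option \<Rightarrow> complex" where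
  "phase (Some PX) (Some PY) = \<i>"
| "phase (Some PX) (Some PZ) = - \<i>"
| "phase (Some PY) (Some PX) = - \<i>"
| "phase (Some PY) (Some PZ) = \<i>"
| "phase (Some PZ) (Some PX) = \<i>"
| "phase (Some PZ) (Some PY) = - \<i>"
| "phase a b = 1"

lemma pauli_option_cases [case_names None X Y Z]:
  assumes "a = None \<Longrightarrow> thesis" "a = Some PX \<Longrightarrow> thesis" "a = Some PY \<Longrightarrow> thesis"
    "a = Some PZ \<Longrightarrow> thesis"
  shows thesis
  using assms by (cases a) (auto intro: pauli.exhaust)

lemma pmul_None_right [simp]: "pmul a None = a"
  by (cases a) auto

lemma phase_None [simp]: "phase None a = 1" "phase a None = 1"
  by (cases a rule: pauli_option_cases; simp)+

lemma pmul_commute: "pmul a b = pmul b a"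
  by (cases a rule: pauli_option_cases; cases b rule: pauli_option_cases; simp)

lemma pmul_assoc: "pmul (pmul a b) c = pmul a (pmul b c)"
  by (cases a rule: pauli_option_cases; cases b rule: pauli_option_cases;
      cases c rule: pauli_option_cases; simp)

lemma pmul_self [simp]: "pmul a a = None" "pmul a (pmul a b) = b"
  by (cases a rule: pauli_option_cases; cases b rule: pauli_option_cases; simp)+

lemma pmul_eq_None_iff [simp]: "pmul a b = None \<longleftrightarrow> a = b"
  by (cases a rule: pauli_option_cases; cases b rule: pauli_option_cases; simp)

lemma site_matrix_mult:
  "(\<Sum>j\<in>UNIV. site_matrix a $ i $ j * site_matrix b $ j $ k) =
    phase a b * site_matrix (pmul a b) $ i $ k"
  using exhaust_2[of i] exhaust_2[of k]
  by (cases a rule: pauli_option_cases; cases b rule: pauli_option_cases;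
      auto simp: sum_2 mat_def)

lemma site_matrix_trace:
  "(\<Sum>i\<in>UNIV. \<Sum>j\<in>UNIV. site_matrix a $ i $ j * site_matrix b $ j $ i) = (if a = b then 2 else 0)"
  by (cases a rule: pauli_option_cases; cases b rule: pauli_option_cases;
      auto simp: sum_2 mat_def)

instance pauli :: finite
proof
  have "(UNIV :: pauli set) = {PX, PY, PZ}"
    using pauli.exhaust by blast
  then show "finite (UNIV :: pauli set)" by (metis finite.emptyI finite_insert)
qed

text \<open>Every element is its own inverse for this sitewise multiplication, so
  \<open>bmul G B\<close> is also the only product that \<open>G\<close> carries to
  \<open>B\<close>.\<close>

definition bmul :: "('v \<rightharpoonup> pauli) \<Rightarrow> ('v \<rightharpoonup> pauli) \<Rightarrow> ('v \<rightharpoonup> pauli)" where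
  "bmul A B = (\<lambda>u. pmul (A u) (B u))"

lemma bmul_apply: "bmul A B u = pmul (A u) (B u)"
  by (simp add: bmul_def)

lemma in_dom_bmul: "s \<in> dom (bmul A B) \<longleftrightarrow> A s \<noteq> B s"
  by (simp add: domIff bmul_apply)

lemma bmul_commute: "bmul A B = bmul B A"
  by (simp add: bmul_def pmul_commute)

lemma bmul_left_commute: "bmul A (bmul B C) = bmul B (bmul A C)"
  unfolding bmul_def by (metis pmul_assoc pmul_commute)

lemma bmul_self [simp]: "bmul A (bmul A B) = B"
  by (simp add: bmul_def)

text \<open>The structure constant of the commutator in the basis of products, as
  \<open>commutator_product_op\<close> shows; it is zero exactly when the two products
  commute.\<close>

definition kappa :: "('v::finite \<rightharpoonup> pauli) \<Rightarrow> ('v \<rightharpoonup> pauli) \<Rightarrow> complex" where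
  "kappa A B = (\<Prod>u\<in>UNIV. phase (A u) (B u)) - (\<Prod>u\<in>UNIV. phase (B u) (A u))"

lemma prod_sum_UNIV:
  fixes f :: "'v::finite \<Rightarrow> 'b::finite \<Rightarrow> 'c::comm_semiring_1"
  shows "(\<Prod>u\<in>UNIV. \<Sum>i\<in>UNIV. f u i) = (\<Sum>g\<in>UNIV. \<Prod>u\<in>UNIV. f u (g u))"
  using prod_sum_PiE[of UNIV "\<lambda>_. UNIV" f] by (simp add: PiE_UNIV_domain)

text \<open>The sum over intermediate configurations of a product over sites factorises into
  sitewise sums, which reduces the claim to the 2 by 2 matrices of
  \<open>site_matrix_mult\<close>.\<close>

lemma product_op_mult:
  "product_op A ** product_op B =
    cscale (\<Prod>u\<in>UNIV. phase (A u) (B u)) (product_op (bmul A B))"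
proof -
  have "(\<Sum>r\<in>UNIV. (\<Prod>u\<in>UNIV. site_matrix (A u) $ s u $ r u) * (\<Prod>u\<in>UNIV. site_matrix (B u) $ r u $ t u))
     = (\<Prod>u\<in>UNIV. phase (A u) (B u)) * (\<Prod>u\<in>UNIV. site_matrix (bmul A B u) $ s u $ t u)"
    for s t :: "'a \<Rightarrow> 2"
    using prod_sum_UNIV[of "\<lambda>u j. site_matrix (A u) $ s u $ j * site_matrix (B u) $ j $ t u"]
    by (simp add: prod.distrib site_matrix_mult bmul_apply)
  then show ?thesis
    by (simp add: product_op_def matrix_matrix_mult_def cscale_def vec_eq_iff)
qed

lemma commutator_product_op:
  "commutator (product_op A) (product_op B) = cscale (kappa A B) (product_op (bmul A B))"
  by (simp add: commutator_def product_op_mult bmul_commute[of B A] kappa_def cscale_def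
      vec_eq_iff algebra_simps)

text \<open>The trace form \<open>M \<mapsto> tr (M B)\<close> separates the products, which gives their linear independence.\<close>

definition trace_with :: "('v::finite \<rightharpoonup> pauli) \<Rightarrow> 'v operator \<Rightarrow> complex" where
  "trace_with B M = (\<Sum>s\<in>UNIV. \<Sum>t\<in>UNIV. M $ s $ t * product_op B $ t $ s)"

lemma trace_with_product_op:
  "trace_with B (product_op A) = (if A = B then 2 ^ CARD('v) else 0)"
  for A B :: "'v::finite \<rightharpoonup> pauli"
proof -
  have "trace_with B (product_op A) =
      (\<Prod>u\<in>UNIV. \<Sum>i\<in>UNIV. \<Sum>j\<in>UNIV. site_matrix (A u) $ i $ j * site_matrix (B u) $ j $ i)"
    by (simp add: trace_with_def product_op_def prod.distrib[symmetric] prod_sum_UNIV)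
  also have "\<dots> = (\<Prod>u\<in>UNIV. if A u = B u then 2 else 0)"
    by (simp add: site_matrix_trace)
  also have "\<dots> = (if A = B then 2 ^ CARD('v) else 0)"
    by (auto simp: fun_eq_iff prod_zero_iff)
  finally show ?thesis .
qed

lemma trace_with_sum: "trace_with B (\<Sum>i\<in>I. f i) = (\<Sum>i\<in>I. trace_with B (f i))"
  by (induction I rule: infinite_finite_induct)
    (simp_all add: trace_with_def sum.distrib algebra_simps)

lemma trace_with_cscale: "trace_with B (cscale c M) = c * trace_with B M"
  by (simp add: trace_with_def cscale_def sum_distrib_left mult.assoc)

lemma trace_with_expansion:
  "trace_with B (\<Sum>A\<in>UNIV. cscale (c A) (product_op A)) = c B * 2 ^ CARD('v)"
  for B :: "'v::finite \<rightharpoonup> pauli"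
  by (simp add: trace_with_sum trace_with_cscale trace_with_product_op if_distrib
      cong: if_cong)

lemma commutator_sum:
  "commutator (\<Sum>i\<in>I. f i) (\<Sum>j\<in>K. g j) = (\<Sum>i\<in>I. \<Sum>j\<in>K. commutator (f i) (g j))"
  if "finite I" "finite K"
proof -
  have add1: "commutator (a + b) c = commutator a c + commutator b c" for a b c :: "'v::finite operator"
    by (simp add: commutator_def matrix_matrix_mult_def vec_eq_iff sum.distrib algebra_simps)
  have add2: "commutator a (b + c) = commutator a b + commutator a c" for a b c :: "'v::finite operator"
    by (simp add: commutator_def matrix_matrix_mult_def vec_eq_iff sum.distrib algebra_simps)
  have z: "commutator 0 a = 0" "commutator a 0 = 0" for a :: "'v::finite operator"
    by (simp_all add: commutator_def)
  have "commutator a (\<Sum>j\<in>K. g j) = (\<Sum>j\<in>K. commutator a (g j))" for a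
    using that(2) by (induction K rule: finite_induct) (simp_all add: add2 z)
  moreover have "commutator (\<Sum>i\<in>I. f i) b = (\<Sum>i\<in>I. commutator (f i) b)" for b
    using that(1) by (induction I rule: finite_induct) (simp_all add: add1 z)
  ultimately show ?thesis by simp (rule sum.swap)
qed

lemma commutator_cscale:
  "commutator (cscale a M) (cscale b N) = cscale (a * b) (commutator M N)"
  by (simp add: commutator_def cscale_def matrix_matrix_mult_def vec_eq_iff sum_distrib_left
      algebra_simps)

lemma cscale_cscale: "cscale a (cscale b M) = cscale (a * b) M"
  by (simp add: cscale_def mult.assoc)

text \<open>Pair both sides with \<open>B\<close> under the trace form. For each \<open>G\<close>
  only \<open>A = bmul G B\<close> survives, because \<open>bmul G\<close> is an involution, and the
  common factor \<open>2 ^ CARD('v)\<close> cancels.\<close>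

lemma commutator_coefficients:
  fixes hc q :: "('v::finite \<rightharpoonup> pauli) \<Rightarrow> complex"
  assumes "commutator (\<Sum>G\<in>UNIV. cscale (hc G) (product_op G)) (\<Sum>A\<in>UNIV. cscale (q A) (product_op A))
    = (\<Sum>A\<in>UNIV. cscale (\<mu> * q A) (product_op A))"
  shows "\<mu> * q B = (\<Sum>G\<in>UNIV. hc G * kappa G (bmul G B) * q (bmul G B))"
proof -
  have "commutator (\<Sum>G\<in>UNIV. cscale (hc G) (product_op G)) (\<Sum>A\<in>UNIV. cscale (q A) (product_op A))
     = (\<Sum>G\<in>UNIV. \<Sum>A\<in>UNIV. cscale (hc G * q A * kappa G A) (product_op (bmul G A)))"
    by (simp add: commutator_sum commutator_cscale commutator_product_op cscale_cscale)
  then have "trace_with B (\<Sum>A\<in>UNIV. cscale (\<mu> * q A) (product_op A))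
     = (\<Sum>G\<in>UNIV. \<Sum>A\<in>UNIV. (hc G * q A * kappa G A) * (if bmul G A = B then 2 ^ CARD('v) else 0))"
    using assms by (simp add: trace_with_sum trace_with_cscale trace_with_product_op)
  moreover have "(\<Sum>A\<in>UNIV. (hc G * q A * kappa G A) * (if bmul G A = B then 2 ^ CARD('v) else 0))
     = hc G * kappa G (bmul G B) * q (bmul G B) * 2 ^ CARD('v)" for G
  proof -
    have "bmul G A = B \<longleftrightarrow> A = bmul G B" for A
      by auto
    then show ?thesis
      by (simp add: if_distrib cong: if_cong)
  qed
  ultimately have "\<mu> * q B * 2 ^ CARD('v) =
      (\<Sum>G\<in>UNIV. hc G * kappa G (bmul G B) * q (bmul G B)) * 2 ^ CARD('v)"
    by (simp add: trace_with_expansion sum_distrib_right)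
  then show ?thesis by simp
qed

section \<open>Bonds and single sites: commutation factors and characters\<close>

definition bond :: "'v \<Rightarrow> 'v \<Rightarrow> pauli \<Rightarrow> 'v \<rightharpoonup> pauli" where
  "bond u v W = [u \<mapsto> W, v \<mapsto> W]"

lemma bond_commute: "bond u v W = bond v u W"
  by (auto simp: bond_def fun_eq_iff)

lemma bond_apply: "bond u v W s = (if s = u \<or> s = v then Some W else None)"
  by (auto simp: bond_def)

lemma kappa_bond:
  assumes "u \<noteq> v"
  shows "kappa (bond u v W) A =
    phase (Some W) (A u) * phase (Some W) (A v) - phase (A u) (Some W) * phase (A v) (Some W)"
proof -
  have 1: "(\<Prod>s\<in>UNIV. f s) = (\<Prod>s\<in>{u, v}. f s)" if "\<And>s. s \<noteq> u \<Longrightarrow> s \<noteq> v \<Longrightarrow> f s = 1"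
    for f :: "'a \<Rightarrow> complex"
    by (rule prod.mono_neutral_right) (use that in auto)
  show ?thesis
    using assms unfolding kappa_def by (simp add: 1 bond_apply)
qed

lemma kappa_site:
  "kappa [u \<mapsto> P] A = phase (Some P) (A u) - phase (A u) (Some P)"
proof -
  have 1: "(\<Prod>s\<in>UNIV. f s) = (\<Prod>s\<in>{u}. f s)" if "\<And>s. s \<noteq> u \<Longrightarrow> f s = 1"
    for f :: "'a \<Rightarrow> complex"
    by (rule prod.mono_neutral_right) (use that in auto)
  show ?thesis
    unfolding kappa_def by (simp add: 1)
qed

lemma site_op_mult:
  assumes "u \<noteq> v"
  shows "site_op P u ** site_op P v = product_op (bond u v P)"
proof -
  have "(\<Prod>s\<in>UNIV. phase ([u \<mapsto> P] s) ([v \<mapsto> P] s)) = 1"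
    by (rule prod.neutral) (use assms in auto)
  moreover have "bmul [u \<mapsto> P] [v \<mapsto> P] = bond u v P"
    using assms by (auto simp: bmul_def bond_def fun_eq_iff)
  ultimately show ?thesis
    by (simp add: site_op_def product_op_mult cscale_def)
qed

text \<open>Conjugation by the global operator \<open>P\<close> at every site multiplies \<open>A\<close> by \<open>chi P A\<close>.\<close>

definition chi :: "pauli \<Rightarrow> ('v::finite \<rightharpoonup> pauli) \<Rightarrow> int" where
  "chi P A = (\<Prod>u\<in>UNIV. if A u = None \<or> A u = Some P then 1 else -1)"

text \<open>For fixed \<open>P\<close> the sign at one site is a homomorphism from the Klein
  four-group to the signs.\<close>

lemma chi_bmul: "chi P (bmul A B) = chi P A * chi P B"
  unfolding chi_def prod.distrib[symmetric]
proof (rule prod.cong)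
  show "(if bmul A B u = None \<or> bmul A B u = Some P then 1 else - 1) =
      (if A u = None \<or> A u = Some P then 1 else - 1) * (if B u = None \<or> B u = Some P then 1 else (- 1::int))"
    for u
    by (cases P; cases "A u" rule: pauli_option_cases; cases "B u" rule: pauli_option_cases)
      (simp_all add: bmul_apply)
qed simp

text \<open>Both ends carry the same letter, so their signs multiply to 1. Multiplication by bonds
  therefore preserves \<open>chi\<close>, whereas by \<open>chi_site\<close> a field term flips it
  for every \<open>P\<close> other than its own letter.\<close>

lemma chi_bond: "chi P (bond u v W) = 1" if "u \<noteq> v"
proof -
  have "chi P (bond u v W) = (\<Prod>s\<in>{u, v}. if bond u v W s = None \<or> bond u v W s = Some P then 1 else -1)"
    unfolding chi_def by (rule prod.mono_neutral_right) (auto simp: bond_apply)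
  then show ?thesis using that by (simp add: bond_apply)
qed

lemma chi_site: "chi P [u \<mapsto> W] = (if P = W then 1 else -1)"
proof -
  have "chi P [u \<mapsto> W] = (\<Prod>s\<in>{u}. if [u \<mapsto> W] s = None \<or> [u \<mapsto> W] s = Some P then 1 else -1)"
    unfolding chi_def by (rule prod.mono_neutral_right) auto
  then show ?thesis by auto
qed

section \<open>Coordinates and widths\<close>

definition cval :: "'l::nontriv mod_ring \<Rightarrow> nat" where
  "cval z = nat (to_int_mod_ring z)"

lemma to_int_mod_ring_bounds: "0 \<le> to_int_mod_ring z" "to_int_mod_ring z < int CARD('l)"
  for z :: "'l::nontriv mod_ring"
  using range_to_int_mod_ring[where 'a = 'l] by (metis atLeastLessThan_iff rangeI)+

lemma cval_less: "cval z < CARD('l)" for z :: "'l::nontriv mod_ring"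
  using to_int_mod_ring_bounds[of z] by (simp add: cval_def)

lemma of_nat_cval [simp]: "of_nat (cval z) = z" for z :: "'l::nontriv mod_ring"
  using to_int_mod_ring_bounds[of z] by (simp add: cval_def of_nat_of_int_mod_ring)

lemma cval_of_nat: "cval (of_nat n :: 'l::nontriv mod_ring) = n mod CARD('l)"
proof -
  have "to_int_mod_ring (of_nat n :: 'l mod_ring) = int n mod int CARD('l)"
    by (simp add: of_nat_of_int_mod_ring of_int_mod_ring.rep_eq to_int_mod_ring.rep_eq)
  then show ?thesis by (simp add: cval_def flip: of_nat_mod)
qed

lemma cval_add_of_nat: "cval (z + of_nat n) = (cval z + n) mod CARD('l)" for z :: "'l::nontriv mod_ring"
  by (metis cval_of_nat of_nat_add of_nat_cval)

lemma cval_eq_iff: "cval y = cval z \<longleftrightarrow> y = z"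
  by (metis of_nat_cval)

lemma of_nat_mod_ring_eq_iff:
  assumes "i < CARD('l)" "j < CARD('l)"
  shows "(of_nat i :: 'l::nontriv mod_ring) = of_nat j \<longleftrightarrow> i = j"
  using assms by (metis cval_of_nat mod_less)

lemma coord_width_arc:
  "\<exists>a. \<forall>u\<in>S. cval (u $ \<alpha> - a) < coord_width \<alpha> S"
  for S :: "('l::nontriv, 'd::finite) site set"
proof -
  \<comment> \<open>The whole circle is an arc of length \<open>CARD('l)\<close>, so the
    \<open>LEAST\<close> in the definition is attained.\<close>
  have "\<exists>k a. \<forall>u\<in>S. to_int_mod_ring (u $ \<alpha> - a) \<in> {0..<int k}"
    using to_int_mod_ring_bounds by (intro exI[of _ "CARD('l)"] exI[of _ 0]) auto
  from LeastI_ex[OF this] show ?thesis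
    unfolding coord_width_def[symmetric] cval_def
    by (metis atLeastLessThan_iff nat_less_iff)
qed

lemma coord_width_le:
  assumes "\<And>u. u \<in> S \<Longrightarrow> cval (u $ \<alpha> - a) < k"
  shows "coord_width \<alpha> S \<le> k"
  unfolding coord_width_def
proof (rule Least_le, rule exI[of _ a], rule ballI)
  fix u assume "u \<in> S"
  then show "to_int_mod_ring (u $ \<alpha> - a) \<in> {0..<int k}"
    using assms[of u] to_int_mod_ring_bounds[of "u $ \<alpha> - a"] by (auto simp: cval_def)
qed

lemma coord_width_le_width: "coord_width \<alpha> S \<le> width S"
  unfolding width_def by (rule Max_ge) auto

lemma width_attained: "\<exists>\<alpha>. coord_width \<alpha> S = width S"
proof -
  have "width S \<in> range (\<lambda>\<alpha>. coord_width \<alpha> S)"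
    unfolding width_def by (rule Max_in) auto
  then show ?thesis by auto
qed

text \<open>A shortest arc has sites of \<open>S\<close> in both of its end slices: an empty last
  slice would allow it to stop one earlier, an empty first slice to start one later.\<close>

lemma coord_width_ends:
  fixes S :: "('l::nontriv, 'd::finite) site set"
  assumes "coord_width \<alpha> S = k" "2 \<le> k"
  shows "\<exists>u\<in>S. \<exists>v\<in>S. v $ \<alpha> = u $ \<alpha> + of_nat (k - 1)"
proof -
  obtain a where a: "\<And>u. u \<in> S \<Longrightarrow> cval (u $ \<alpha> - a) < k"
    using coord_width_arc[of S \<alpha>] assms(1) by auto
  have "\<exists>v\<in>S. cval (v $ \<alpha> - a) = k - 1"
  proof (rule ccontr)
    assume "\<not> ?thesis"
    then have "cval (u $ \<alpha> - a) < k - 1" if "u \<in> S" for u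
      using a that by (metis Suc_pred' assms(2) less_Suc_eq less_le_trans pos2)
    from coord_width_le[where S = S and k = "k - 1", OF this] assms show False by simp
  qed
  then obtain v where v: "v \<in> S" "cval (v $ \<alpha> - a) = k - 1" by auto
  have "\<exists>u\<in>S. u $ \<alpha> = a"
  proof (rule ccontr)
    assume no: "\<not> ?thesis"
    \<comment> \<open>No site has offset 0, so moving the origin to \<open>a + 1\<close> lowers
      every offset by exactly one and nothing wraps around.\<close>
    have "cval (u $ \<alpha> - (a + 1)) < k - 1" if "u \<in> S" for u
    proof -
      have "cval (u $ \<alpha> - a) \<noteq> 0"
        using no that by (metis cval_eq_iff cval_of_nat mod_0 of_nat_0 right_minus_eq)
      moreover have "u $ \<alpha> - a = (u $ \<alpha> - (a + 1)) + of_nat 1" by simp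
      then have "cval (u $ \<alpha> - a) = (cval (u $ \<alpha> - (a + 1)) + 1) mod CARD('l)"
        by (metis cval_add_of_nat)
      ultimately have "cval (u $ \<alpha> - a) = cval (u $ \<alpha> - (a + 1)) + 1"
        using cval_less[of "u $ \<alpha> - (a + 1)"]
        by (metis Suc_eq_plus1 Suc_lessI mod_less mod_self)
      then show ?thesis using a[OF that] by simp
    qed
    from coord_width_le[where S = S and k = "k - 1", OF this] assms show False by simp
  qed
  then obtain u where "u \<in> S" "u $ \<alpha> = a" by auto
  moreover have "v $ \<alpha> = a + of_nat (k - 1)"
    using v(2) by (metis add_diff_cancel_left' add.commute diff_add_cancel of_nat_cval)
  ultimately show ?thesis using v by auto
qed

lemma nearest_neighbours_commute: "nearest_neighbours u v \<longleftrightarrow> nearest_neighbours v u"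
proof -
  have "a - b = 1 \<or> a - b = -1 \<longleftrightarrow> b - a = 1 \<or> b - a = -1" for a b :: "'a mod_ring"
    by (metis minus_diff_eq minus_minus)
  then show ?thesis unfolding nearest_neighbours_def by metis
qed

lemma nearest_neighbours_irrefl: "nearest_neighbours u v \<Longrightarrow> u \<noteq> v"
  unfolding nearest_neighbours_def by auto

section \<open>The Hamiltonian in the basis of products\<close>

lemma UNIV_pauli: "UNIV = {PX, PY, PZ}"
  using pauli.exhaust by blast

lemma cscale_of_real: "cscale (of_real r) M = r *\<^sub>R M"
  by (simp add: cscale_def vec_eq_iff) (simp add: scaleR_conv_of_real)

lemma cscale_sum_left: "cscale (\<Sum>i\<in>I. c i) M = (\<Sum>i\<in>I. cscale (c i) M)"
  by (simp add: cscale_def vec_eq_iff sum_distrib_right)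

text \<open>The map \<open>g\<close> may repeat values; the coefficient at \<open>G\<close> gathers
  all indices that it sends to \<open>G\<close>.\<close>

lemma collect_coefficients:
  fixes g :: "'i \<Rightarrow> 'v::finite \<rightharpoonup> pauli"
  shows "(\<Sum>i\<in>I. cscale (c i) (product_op (g i))) =
    (\<Sum>G\<in>UNIV. cscale (\<Sum>i\<in>I. if g i = G then c i else 0) (product_op G))"
proof -
  have "(\<Sum>G\<in>UNIV. cscale (\<Sum>i\<in>I. if g i = G then c i else 0) (product_op G)) =
      (\<Sum>i\<in>I. \<Sum>G\<in>UNIV. cscale (if g i = G then c i else 0) (product_op G))"
    by (simp add: cscale_sum_left) (rule sum.swap)
  also have "\<dots> = (\<Sum>i\<in>I. \<Sum>G\<in>UNIV. if g i = G then cscale (c i) (product_op G) else 0)"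
    by (intro sum.cong refl) (auto simp: cscale_def vec_eq_iff)
  also have "\<dots> = (\<Sum>i\<in>I. cscale (c i) (product_op (g i)))"
    by simp
  finally show ?thesis by simp
qed

lemma bond_eq_iff:
  assumes "u \<noteq> v"
  shows "bond u' v' W' = bond u v W \<longleftrightarrow> W' = W \<and> (u' = u \<and> v' = v \<or> u' = v \<and> v' = u)"
proof
  assume eq: "bond u' v' W' = bond u v W"
  then have "\<And>s. bond u' v' W' s = bond u v W s" by simp
  from this[of u] this[of v] this[of u'] this[of v'] assms
  show "W' = W \<and> (u' = u \<and> v' = v \<or> u' = v \<and> v' = u)"
    by (auto simp: bond_apply split: if_splits)
qed (auto simp: bond_commute)

lemma bond_neq_site: "u \<noteq> v \<Longrightarrow> [s \<mapsto> P] \<noteq> bond u v W"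
proof
  assume "u \<noteq> v" "[s \<mapsto> P] = bond u v W"
  from this(2) have "\<And>x. [s \<mapsto> P] x = bond u v W x" by simp
  from this[of u] this[of v] \<open>u \<noteq> v\<close> show False by (auto simp: bond_apply split: if_splits)
qed

text \<open>Each bond occurs for both orders of its ends, which cancels the prefactor
  \<open>1/2\<close>. Of the field terms only the form is recorded, not the strength.\<close>

lemma hamiltonian_expansion:
  fixes Jx Jy Jz hx hy hz :: real
  defines "J \<equiv> \<lambda>P. case P of PX \<Rightarrow> Jx | PY \<Rightarrow> Jy | PZ \<Rightarrow> Jz"
  obtains hc :: "(('l::nontriv, 'd::finite) site \<rightharpoonup> pauli) \<Rightarrow> complex" where
    "hamiltonian Jx Jy Jz hx hy hz = (\<Sum>G\<in>UNIV. cscale (hc G) (product_op G))"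
    "\<And>u v W. nearest_neighbours u v \<Longrightarrow> hc (bond u v W) = - of_real (J W)"
    "\<And>G. hc G \<noteq> 0 \<Longrightarrow> (\<exists>u P. G = [u \<mapsto> P]) \<or> (\<exists>u v W. nearest_neighbours u v \<and> G = bond u v W)"
proof -
  define h where "h = (\<lambda>P. case P of PX \<Rightarrow> hx | PY \<Rightarrow> hy | PZ \<Rightarrow> hz)"
  define N where "N = {(u, v). nearest_neighbours u (v :: ('l, 'd) site)}"
  define I1 where "I1 = N \<times> (UNIV :: pauli set)"
  define I2 where "I2 = (UNIV :: (('l, 'd) site \<times> pauli) set)"
  define c1 :: "(('l, 'd) site \<times> ('l, 'd) site) \<times> pauli \<Rightarrow> complex"
    where "c1 = (\<lambda>(uv, W). - of_real (J W) / 2)"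
  define g1 :: "(('l, 'd) site \<times> ('l, 'd) site) \<times> pauli \<Rightarrow> _"
    where "g1 = (\<lambda>((u, v), W). bond u v W)"
  define c2 :: "('l, 'd) site \<times> pauli \<Rightarrow> complex" where "c2 = (\<lambda>(u, P). - of_real (h P))"
  define g2 :: "('l, 'd) site \<times> pauli \<Rightarrow> ('l, 'd) site \<rightharpoonup> pauli"
    where "g2 = (\<lambda>(u, P). [u \<mapsto> P])"
  define hc where "hc = (\<lambda>G. (\<Sum>i\<in>I1. if g1 i = G then c1 i else 0) + (\<Sum>i\<in>I2. if g2 i = G then c2 i else 0))"
  have "(\<Sum>W\<in>UNIV. cscale (c1 ((u, v), W)) (product_op (g1 ((u, v), W)))) =
      - (1/2) *\<^sub>R (Jx *\<^sub>R (site_op PX u ** site_op PX v) + Jy *\<^sub>R (site_op PY u ** site_op PY v)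
       + Jz *\<^sub>R (site_op PZ u ** site_op PZ v))" if "(u, v) \<in> N" for u v
  proof -
    have "u \<noteq> v" using that nearest_neighbours_irrefl by (auto simp: N_def)
    moreover have "c1 ((u, v), W) = of_real (- (1/2) * J W)" for W by (simp add: c1_def)
    ultimately show ?thesis
      by (simp only: cscale_of_real g1_def split J_def UNIV_pauli)
        (simp add: scaleR_add_right site_op_mult)
  qed
  then have "(\<Sum>i\<in>I1. cscale (c1 i) (product_op (g1 i))) =
      (\<Sum>(u, v)\<in>N. - (1/2) *\<^sub>R (Jx *\<^sub>R (site_op PX u ** site_op PX v) + Jy *\<^sub>R (site_op PY u ** site_op PY v)
       + Jz *\<^sub>R (site_op PZ u ** site_op PZ v)))"
    unfolding I1_def sum.cartesian_product[symmetric, of "\<lambda>uv W. cscale (c1 (uv, W)) (product_op (g1 (uv, W)))", simplified]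
    by (intro sum.cong refl) auto
  moreover have "(\<Sum>i\<in>I2. cscale (c2 i) (product_op (g2 i))) =
      - (\<Sum>u\<in>UNIV. hx *\<^sub>R site_op PX u + hy *\<^sub>R site_op PY u + hz *\<^sub>R site_op PZ u)"
  proof -
    have "c2 (u, P) = of_real (- h P)" for u P by (simp add: c2_def)
    then have "(\<Sum>P\<in>UNIV. cscale (c2 (u, P)) (product_op (g2 (u, P)))) =
       - (hx *\<^sub>R site_op PX u + hy *\<^sub>R site_op PY u + hz *\<^sub>R site_op PZ u)" for u
      by (simp only: cscale_of_real g2_def split h_def UNIV_pauli)
        (simp add: site_op_def)
    note * = this
    have "(\<Sum>i\<in>I2. cscale (c2 i) (product_op (g2 i))) =
        (\<Sum>u\<in>UNIV. \<Sum>P\<in>UNIV. cscale (c2 (u, P)) (product_op (g2 (u, P))))"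
      by (simp add: I2_def sum.cartesian_product)
    then show ?thesis by (simp only: * sum_negf)
  qed
  ultimately have "hamiltonian Jx Jy Jz hx hy hz =
      (\<Sum>i\<in>I1. cscale (c1 i) (product_op (g1 i))) + (\<Sum>i\<in>I2. cscale (c2 i) (product_op (g2 i)))"
    by (simp add: hamiltonian_def N_def scaleR_sum_right sum_negf case_prod_unfold)
  also have "\<dots> = (\<Sum>G\<in>UNIV. cscale (hc G) (product_op G))"
    unfolding collect_coefficients[of c1] collect_coefficients[of c2] sum.distrib[symmetric] hc_def
    by (intro sum.cong refl) (simp add: cscale_def vec_eq_iff distrib_right)
  finally have 1: "hamiltonian Jx Jy Jz hx hy hz = (\<Sum>G\<in>UNIV. cscale (hc G) (product_op G))" .
  have 2: "hc (bond u v W) = - of_real (J W)" if nn: "nearest_neighbours u v" for u v W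
  proof -
    have neq: "u \<noteq> v" using nn nearest_neighbours_irrefl by blast
    \<comment> \<open>Exactly the two orderings of the pair index this bond.\<close>
    have "(\<Sum>i\<in>I1. if g1 i = bond u v W then c1 i else 0) =
        (\<Sum>i\<in>{((u, v), W), ((v, u), W)}. if g1 i = bond u v W then c1 i else 0)"
      by (rule sum.mono_neutral_right)
        (use nn nearest_neighbours_commute[of u v] neq in \<open>auto simp: I1_def N_def g1_def bond_eq_iff\<close>)
    also have "\<dots> = - of_real (J W)"
      using neq by (simp add: g1_def c1_def bond_commute)
    finally show ?thesis
      using neq by (simp add: hc_def g2_def case_prod_unfold bond_neq_site)
  qed
  have 3: "(\<exists>u P. G = [u \<mapsto> P]) \<or> (\<exists>u v W. nearest_neighbours u v \<and> G = bond u v W)"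
    if "hc G \<noteq> 0" for G
  proof -
    from that have "(\<Sum>i\<in>I1. if g1 i = G then c1 i else 0) \<noteq> 0 \<or> (\<Sum>i\<in>I2. if g2 i = G then c2 i else 0) \<noteq> 0"
      by (auto simp: hc_def)
    then show ?thesis
    proof
      assume "(\<Sum>i\<in>I1. if g1 i = G then c1 i else 0) \<noteq> 0"
      then obtain i where "i \<in> I1" "(if g1 i = G then c1 i else 0) \<noteq> 0"
        by (rule sum.not_neutral_contains_not_neutral)
      then show ?thesis by (auto simp: I1_def g1_def N_def split: if_splits) blast
    next
      assume "(\<Sum>i\<in>I2. if g2 i = G then c2 i else 0) \<noteq> 0"
      then obtain i where "i \<in> I2" "(if g2 i = G then c2 i else 0) \<noteq> 0"
        by (rule sum.not_neutral_contains_not_neutral)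
      then show ?thesis by (cases i) (auto simp: g2_def split: if_splits)
    qed
  qed
  show thesis using that 1 2 3 by blast
qed

section \<open>Lattice geometry\<close>

definition shift :: "'d \<Rightarrow> nat \<Rightarrow> ('l::nontriv, 'd::finite) site \<Rightarrow> ('l, 'd) site" where
  "shift \<alpha> n x = x + axis \<alpha> (of_nat n)"

lemma shift_nth: "shift \<alpha> n x $ \<beta> = (if \<beta> = \<alpha> then x $ \<beta> + of_nat n else x $ \<beta>)"
  by (simp add: shift_def axis_def)

lemma shift_0 [simp]: "shift \<alpha> 0 x = x"
  by (simp add: vec_eq_iff shift_nth)

lemma shift_shift [simp]: "shift \<alpha> m (shift \<alpha> n x) = shift \<alpha> (n + m) x"
  by (simp add: vec_eq_iff shift_nth add.assoc)

lemma shift_CARD: "shift \<alpha> CARD('l) x = x" for x :: "('l::nontriv, 'd::finite) site"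
  by (simp add: vec_eq_iff shift_nth)

lemma shift_inj_site: "shift \<alpha> n x = shift \<alpha> n y \<longleftrightarrow> x = y"
  by (simp add: shift_def)

lemma shift_eq_iff [simp]:
  fixes x :: "('l::nontriv, 'd::finite) site"
  assumes "i < CARD('l)" "j < CARD('l)"
  shows "shift \<alpha> i x = shift \<alpha> j x \<longleftrightarrow> i = j"
proof
  assume "shift \<alpha> i x = shift \<alpha> j x"
  then have "shift \<alpha> i x $ \<alpha> = shift \<alpha> j x $ \<alpha>" by simp
  then show "i = j" using assms by (simp add: shift_nth of_nat_mod_ring_eq_iff)
qed simp

lemma shift_eq_self_iff [simp]:
  fixes x :: "('l::nontriv, 'd::finite) site"
  assumes "i < CARD('l)"
  shows "shift \<alpha> i x = x \<longleftrightarrow> i = 0" "x = shift \<alpha> i x \<longleftrightarrow> i = 0"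
  using shift_eq_iff[OF assms, of 0 \<alpha> x] by auto

lemma nearest_neighbours_iff:
  "nearest_neighbours u v \<longleftrightarrow> (\<exists>\<alpha>. v = shift \<alpha> 1 u \<or> u = shift \<alpha> 1 v)"
proof -
  have "v = shift \<alpha> 1 u \<longleftrightarrow> u $ \<alpha> - v $ \<alpha> = - 1 \<and> (\<forall>\<beta>. \<beta> \<noteq> \<alpha> \<longrightarrow> u $ \<beta> = v $ \<beta>)"
    "u = shift \<alpha> 1 v \<longleftrightarrow> u $ \<alpha> - v $ \<alpha> = 1 \<and> (\<forall>\<beta>. \<beta> \<noteq> \<alpha> \<longrightarrow> u $ \<beta> = v $ \<beta>)" for \<alpha>
    by (auto simp: vec_eq_iff shift_nth algebra_simps)
  then show ?thesis unfolding nearest_neighbours_def by auto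
qed

lemma nearest_neighbours_shift [simp]: "nearest_neighbours u (shift \<alpha> (Suc 0) u)"
  "nearest_neighbours (shift \<alpha> (Suc 0) u) u"
  by (auto simp: nearest_neighbours_iff)

text \<open>Shifts take natural numbers, so a backward step is written as
  \<open>CARD('l) - 1\<close> forward steps.\<close>

lemma shift_diff_eq: "u = shift \<alpha> 1 v \<longleftrightarrow> v = shift \<alpha> (CARD('l) - 1) u"
  for u :: "('l::nontriv, 'd::finite) site"
proof
  have L: "1 + (CARD('l) - 1) = CARD('l)" "CARD('l) - 1 + 1 = CARD('l)" by simp_all
  show "u = shift \<alpha> 1 v \<Longrightarrow> v = shift \<alpha> (CARD('l) - 1) u"
    by (simp only: shift_shift L shift_CARD)
  show "v = shift \<alpha> (CARD('l) - 1) u \<Longrightarrow> u = shift \<alpha> 1 v"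
    by (simp only: shift_shift L shift_CARD)
qed

lemma neighbour_cases:
  fixes u v :: "('l::nontriv, 'd::finite) site"
  assumes "nearest_neighbours u v"
  obtains (same) "v $ \<alpha> = u $ \<alpha>" | (up) "v = shift \<alpha> 1 u" | (down) "u = shift \<alpha> 1 v"
  using assms unfolding nearest_neighbours_iff by (metis shift_nth)

definition line :: "'d \<Rightarrow> nat \<Rightarrow> ('l::nontriv, 'd::finite) site \<Rightarrow> ('l, 'd) site set" where
  "line \<alpha> m x = (\<lambda>i. shift \<alpha> i x) ` {..<m}"

section \<open>Strings\<close>

lemma shift_in_line [simp]:
  fixes x :: "('l::nontriv, 'd::finite) site"
  assumes "i < CARD('l)" "m \<le> CARD('l)"
  shows "shift \<alpha> i x \<in> line \<alpha> m x \<longleftrightarrow> i < m"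
  using assms by (auto simp: line_def)

lemma line_shift:
  fixes x :: "('l::nontriv, 'd::finite) site"
  assumes "0 < m" "m < CARD('l)"
  shows "insert (shift \<alpha> m x) (line \<alpha> m x) - {x} = line \<alpha> m (shift \<alpha> 1 x)"
proof -
  have "insert (shift \<alpha> m x) (line \<alpha> m x) = (\<lambda>i. shift \<alpha> i x) ` {..m}"
    by (simp add: line_def flip: lessThan_Suc_atMost) (simp add: lessThan_Suc)
  also have "{..m} = insert 0 (Suc ` {..<m})"
    by (simp add: lessThan_Suc_eq_insert_0 flip: lessThan_Suc_atMost)
  finally have "insert (shift \<alpha> m x) (line \<alpha> m x) = insert x ((\<lambda>i. shift \<alpha> (Suc i) x) ` {..<m})"
    by (simp add: image_image)
  moreover have "x \<notin> (\<lambda>i. shift \<alpha> (Suc i) x) ` {..<m}"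
    using assms by auto
  ultimately show ?thesis by (simp add: line_def)
qed

text \<open>A step in a direction other than \<alpha> changes a coordinate that is constant along
  the line, and the bounds on \<open>i\<close> and \<open>j\<close> keep the line from closing up
  around the torus.\<close>

lemma nearest_neighbours_on_line:
  fixes x :: "('l::nontriv, 'd::finite) site"
  assumes "nearest_neighbours (shift \<alpha> i x) (shift \<alpha> j x)" "i + 1 < CARD('l)" "j + 1 < CARD('l)"
  shows "j = i + 1 \<or> i = j + 1"
proof -
  obtain \<gamma> where \<gamma>: "shift \<alpha> j x = shift \<gamma> 1 (shift \<alpha> i x) \<or> shift \<alpha> i x = shift \<gamma> 1 (shift \<alpha> j x)"
    using assms(1) unfolding nearest_neighbours_iff by auto
  have "\<gamma> = \<alpha>"
  proof (rule ccontr)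
    assume "\<gamma> \<noteq> \<alpha>"
    from \<gamma> show False
    proof
      assume "shift \<alpha> j x = shift \<gamma> 1 (shift \<alpha> i x)"
      from arg_cong[OF this, of "\<lambda>s. s $ \<gamma>"] \<open>\<gamma> \<noteq> \<alpha>\<close> show False by (simp add: shift_nth)
    next
      assume "shift \<alpha> i x = shift \<gamma> 1 (shift \<alpha> j x)"
      from arg_cong[OF this, of "\<lambda>s. s $ \<gamma>"] \<open>\<gamma> \<noteq> \<alpha>\<close> show False by (simp add: shift_nth)
    qed
  qed
  then show ?thesis using \<gamma> assms(2,3) by auto
qed

text \<open>Multiplication by Z exchanges X and Y up to a phase; with Booleans this exchange becomes
  negation.\<close>

definition xy :: "bool \<Rightarrow> pauli" where
  "xy b = (if b then PX else PY)"

lemma pmul_xy [simp]: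
  "pmul (Some (xy b)) (Some PZ) = Some (xy (\<not> b))"
  "pmul (Some PZ) (Some (xy b)) = Some (xy (\<not> b))"
  "pmul (Some (xy b)) (Some (xy (\<not> b))) = Some PZ"
  "pmul (Some (xy (\<not> b))) (Some (xy b)) = Some PZ"
  by (cases b; simp add: xy_def)+

lemma xy_eq_iff [simp]: "xy b = xy c \<longleftrightarrow> b = c" "xy b \<noteq> PZ" "PZ \<noteq> xy b"
  by (auto simp: xy_def)

lemma ex_xy: "a = Some PX \<or> a = Some PY \<Longrightarrow> \<exists>b. a = Some (xy b)"
  by (metis xy_def)

text \<open>The sign in which the phases of X and Y differ, see \<open>phase_xy\<close>.\<close>

definition sgb :: "bool \<Rightarrow> complex" where
  "sgb b = (if b then 1 else -1)"

lemma phase_xy [simp]: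
  "phase (Some (xy b)) (Some (xy (\<not> b))) = \<i> * sgb b"
  "phase (Some (xy (\<not> b))) (Some (xy b)) = - \<i> * sgb b"
  "phase (Some (xy b)) (Some PZ) = - \<i> * sgb b"
  "phase (Some PZ) (Some (xy b)) = \<i> * sgb b"
  by (cases b; simp add: xy_def sgb_def)+

text \<open>The string with the Pauli matrices \<open>c\<close>, \<open>c'\<close> at the ends of a straight segment of \<open>m\<close> sites
  and \<open>Z\<close> in between, where \<open>c, c' \<in> {X, Y}\<close> are encoded as Booleans.\<close>

definition str :: "'d \<Rightarrow> nat \<Rightarrow> ('l::nontriv, 'd::finite) site \<Rightarrow> bool \<Rightarrow> bool
    \<Rightarrow> ('l, 'd) site \<rightharpoonup> pauli" where
  "str \<alpha> m x b b' = (\<lambda>s. if s \<in> line \<alpha> m x then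
     Some (if s = x then xy b else if s = shift \<alpha> (m - 1) x then xy b' else PZ) else None)"

lemma dom_str [simp]: "dom (str \<alpha> m x b b') = line \<alpha> m x"
  by (auto simp: str_def split: if_splits)

lemma str_outside: "s \<notin> line \<alpha> m x \<Longrightarrow> str \<alpha> m x b b' s = None"
  by (simp add: str_def)

lemma str_shift:
  fixes x :: "('l::nontriv, 'd::finite) site"
  assumes "i < CARD('l)" "m \<le> CARD('l)" "0 < m"
  shows "str \<alpha> m x b b' (shift \<alpha> i x) =
    (if i < m then Some (if i = 0 then xy b else if i = m - 1 then xy b' else PZ) else None)"
proof -
  have "shift \<alpha> i x = shift \<alpha> (m - 1) x \<longleftrightarrow> i = m - 1"
    by (rule shift_eq_iff) (use assms in auto)
  then show ?thesis using assms by (simp add: str_def)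
qed

lemma str_first:
  fixes x :: "('l::nontriv, 'd::finite) site"
  assumes "m \<le> CARD('l)" "0 < m"
  shows "str \<alpha> m x b b' x = Some (xy b)"
  using str_shift[of 0 m \<alpha> x b b'] assms by simp

lemma str_eqI:
  fixes x :: "('l::nontriv, 'd::finite) site"
  assumes "dom A = line \<alpha> m x" "2 \<le> m" "m \<le> CARD('l)" "A x = Some (xy b)"
    "A (shift \<alpha> (m - 1) x) = Some (xy b')"
    "\<And>i. 1 \<le> i \<Longrightarrow> i < m - 1 \<Longrightarrow> A (shift \<alpha> i x) = Some PZ"
  shows "A = str \<alpha> m x b b'"
proof
  fix s
  show "A s = str \<alpha> m x b b' s"
  proof (cases "s \<in> line \<alpha> m x")
    case True
    then obtain i where i: "i < m" "s = shift \<alpha> i x" by (auto simp: line_def)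
    then consider "i = 0" | "i = m - 1" "i \<noteq> 0" | "1 \<le> i" "i < m - 1" by linarith
    then show ?thesis
      using assms i by cases (auto simp: str_shift str_first)
  next
    case False
    then show ?thesis using assms(1) by (metis domIff str_outside)
  qed
qed

text \<open>The bond cancels the end letter and turns the Z at the next site into the flipped
  letter. Since \<open>3 \<le> m\<close>, that site is interior and does carry Z.\<close>

lemma bond_str_left:
  fixes x :: "('l::nontriv, 'd::finite) site"
  assumes "3 \<le> m" "m \<le> CARD('l)"
  shows "bmul (bond x (shift \<alpha> 1 x) (xy b)) (str \<alpha> m x b b') = str \<alpha> (m - 1) (shift \<alpha> 1 x) (\<not> b) b'"
proof (rule str_eqI)
  let ?A = "bmul (bond x (shift \<alpha> 1 x) (xy b)) (str \<alpha> m x b b')"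
  have 1: "?A (shift \<alpha> i x) = (if i = 0 then None else if i = 1 then Some (xy (\<not> b))
      else if i = m - 1 then Some (xy b') else Some PZ)" if "i < m" for i
    using that assms by (auto simp: bmul_apply bond_apply str_shift)
  have "s \<in> dom ?A \<longleftrightarrow> s \<in> line \<alpha> m x - {x}" for s
  proof (cases "s \<in> line \<alpha> m x")
    case True
    then obtain i where i: "i < m" "s = shift \<alpha> i x" by (auto simp: line_def)
    then show ?thesis using 1[OF i(1)] assms by (simp add: domIff)
  next
    case False
    moreover have "x \<in> line \<alpha> m x" "shift \<alpha> 1 x \<in> line \<alpha> m x"
      using shift_in_line[of 0 m \<alpha> x] shift_in_line[of 1 m \<alpha> x] assms by auto
    ultimately show ?thesis by (auto simp: in_dom_bmul bond_apply str_outside)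
  qed
  moreover have "insert (shift \<alpha> (m - 1) x) (line \<alpha> (m - 1) x) = line \<alpha> m x"
  proof -
    have "{..<m} = insert (m - 1) {..<m - 1}" using assms by auto
    then show ?thesis by (simp add: line_def)
  qed
  moreover have "insert (shift \<alpha> (m - 1) x) (line \<alpha> (m - 1) x) - {x} = line \<alpha> (m - 1) (shift \<alpha> 1 x)"
    by (rule line_shift) (use assms in auto)
  ultimately show "dom ?A = line \<alpha> (m - 1) (shift \<alpha> 1 x)" by blast
  show "?A (shift \<alpha> 1 x) = Some (xy (\<not> b))" using 1[of 1] assms by simp
  have "1 + (m - 1 - 1) = m - 1" "m - 1 \<noteq> 1" using assms by auto
  then show "?A (shift \<alpha> (m - 1 - 1) (shift \<alpha> 1 x)) = Some (xy b')"
    using 1[of "m - 1"] assms by (simp only: shift_shift) simp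
  show "?A (shift \<alpha> i (shift \<alpha> 1 x)) = Some PZ" if "1 \<le> i" "i < m - 1 - 1" for i
    using 1[of "Suc i"] assms that by simp
qed (use assms in auto)

text \<open>Mirror image of \<open>bond_str_left\<close>; the site to be removed is again the first
  one listed in the bond.\<close>

lemma bond_str_right:
  fixes x :: "('l::nontriv, 'd::finite) site"
  assumes "3 \<le> m" "m \<le> CARD('l)"
  shows "bmul (bond (shift \<alpha> (m - 1) x) (shift \<alpha> (m - 2) x) (xy b')) (str \<alpha> m x b b')
    = str \<alpha> (m - 1) x b (\<not> b')"
proof (rule str_eqI)
  let ?A = "bmul (bond (shift \<alpha> (m - 1) x) (shift \<alpha> (m - 2) x) (xy b')) (str \<alpha> m x b b')"
  have 1: "?A (shift \<alpha> i x) = (if i = 0 then Some (xy b) else if i = m - 1 then None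
      else if i = m - 2 then Some (xy (\<not> b')) else Some PZ)" if "i < m" for i
    using that assms by (auto simp: bmul_apply bond_apply str_shift)
  have 2: "shift \<alpha> (m - 1) x \<in> line \<alpha> m x" "shift \<alpha> (m - 2) x \<in> line \<alpha> m x"
    using assms by auto
  have *: "line \<alpha> (m - 1) x = line \<alpha> m x - {shift \<alpha> (m - 1) x}"
  proof -
    have "{..<m} = insert (m - 1) {..<m - 1}" using assms by auto
    then have "line \<alpha> m x = insert (shift \<alpha> (m - 1) x) (line \<alpha> (m - 1) x)" by (simp add: line_def)
    moreover have "shift \<alpha> (m - 1) x \<notin> line \<alpha> (m - 1) x" using assms by simp
    ultimately show ?thesis by auto
  qed
  have "s \<in> dom ?A \<longleftrightarrow> s \<in> line \<alpha> m x - {shift \<alpha> (m - 1) x}" for s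
  proof (cases "s \<in> line \<alpha> m x")
    case True
    then obtain i where i: "i < m" "s = shift \<alpha> i x" by (auto simp: line_def)
    moreover have "shift \<alpha> i x = shift \<alpha> (m - 1) x \<longleftrightarrow> i = m - 1"
      by (rule shift_eq_iff) (use assms i in auto)
    ultimately show ?thesis using 1[OF i(1)] assms by (simp add: domIff)
  next
    case False
    then show ?thesis using 2 by (auto simp: in_dom_bmul bond_apply str_outside)
  qed
  then show "dom ?A = line \<alpha> (m - 1) x" unfolding * by blast
  show "?A x = Some (xy b)" using 1[of 0] assms by simp
  show "?A (shift \<alpha> (m - 1 - 1) x) = Some (xy (\<not> b'))" using 1[of "m - 2"] assms
    by (simp add: numeral_2_eq_2)
  show "?A (shift \<alpha> i x) = Some PZ" if "1 \<le> i" "i < m - 1 - 1" for i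
  proof -
    have "i < m" "i \<noteq> 0" "i \<noteq> m - 1" "i \<noteq> m - 2" using that by auto
    then show ?thesis using 1[of i] by simp
  qed
qed (use assms in auto)

text \<open>Strings of proper parity are, up to a phase, products of the bonds \<open>XX\<close> and \<open>YY\<close> along the
  segment.\<close>

definition proper :: "nat \<Rightarrow> bool \<Rightarrow> bool \<Rightarrow> bool" where
  "proper m b b' \<longleftrightarrow> (even m \<longleftrightarrow> b = b')"

text \<open>A proper string is a product of bonds up to a phase: the induction strips one bond after
  another from the right end, flipping \<open>b'\<close> each time, until a single bond is left at
  length 2.\<close>

lemma chi_str:
  fixes x :: "('l::nontriv, 'd::finite) site"
  assumes "2 \<le> m" "m \<le> CARD('l)" "proper m b b'"
  shows "chi P (str \<alpha> m x b b') = 1"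
  using assms
proof (induction m arbitrary: b' rule: nat_induct_at_least)
  case base
  then have b: "b' = b" and L: "1 < CARD('l)" by (auto simp: proper_def)
  have "line \<alpha> 2 x = {x, shift \<alpha> 1 x}" by (auto simp: line_def numeral_2_eq_2 lessThan_Suc)
  then have "bond x (shift \<alpha> 1 x) (xy b) = str \<alpha> 2 x b b'"
    using base b by (intro str_eqI) (auto simp: bond_def)
  moreover have "x \<noteq> shift \<alpha> 1 x" using L by simp
  ultimately show ?case by (metis chi_bond)
next
  case (Suc m)
  let ?G = "bond (shift \<alpha> m x) (shift \<alpha> (m - 1) x) (xy b')"
  have "bmul ?G (str \<alpha> (Suc m) x b b') = str \<alpha> m x b (\<not> b')"
    using bond_str_right[of "Suc m" \<alpha> x b' b] Suc.hyps Suc.prems by simp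
  then have "str \<alpha> (Suc m) x b b' = bmul ?G (str \<alpha> m x b (\<not> b'))" by (metis bmul_self)
  moreover have "chi P (str \<alpha> m x b (\<not> b')) = 1"
    by (rule Suc.IH) (use Suc.prems in \<open>auto simp: proper_def\<close>)
  moreover have "shift \<alpha> m x \<noteq> shift \<alpha> (m - 1) x"
    using Suc.hyps Suc.prems by (subst shift_eq_iff) auto
  ultimately show ?case by (simp add: chi_bmul chi_bond)
qed

section \<open>Telescoping\<close>

text \<open>The factors are those for which \<open>telescoping_factor \<sigma> \<tau> n * Q n\<close> does not depend on \<open>n\<close>
  when \<open>Q\<close> satisfies the recurrence below.\<close>

fun telescoping_factor :: "(nat \<Rightarrow> complex) \<Rightarrow> (nat \<Rightarrow> complex) \<Rightarrow> nat \<Rightarrow> complex" where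
  "telescoping_factor \<sigma> \<tau> 0 = 1"
| "telescoping_factor \<sigma> \<tau> (Suc n) = - telescoping_factor \<sigma> \<tau> n * \<sigma> n / \<tau> (Suc n)"

text \<open>Weight the equation number \<open>n\<close> by \<open>c n\<close>. By \<open>rec\<close>
  all left sides become \<open>m * Q 0\<close>, and since
  \<open>c n * \<sigma> n = - c (Suc n) * \<tau> (Suc n)\<close> neighbouring \<open>P\<close> terms
  cancel, leaving the two boundary terms.\<close>

lemma telescoping:
  assumes eq: "\<And>n. n < N \<Longrightarrow> m * Q n = \<sigma> n * P (Suc n) + \<tau> n * P n"
    and rec: "\<And>n. Suc n < N \<Longrightarrow> \<sigma> n * Q (Suc n) = - \<tau> (Suc n) * Q n"
    and nz: "\<And>n. \<tau> n \<noteq> 0"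
  shows "of_nat N * m * Q 0 = \<tau> 0 * P 0 - telescoping_factor \<sigma> \<tau> N * \<tau> N * P N"
proof -
  define c where "c = telescoping_factor \<sigma> \<tau>"
  have c: "c 0 = 1" "c (Suc n) * \<tau> (Suc n) = - c n * \<sigma> n" for n
    using nz by (auto simp: c_def)
  have const: "c n * Q n = Q 0" if "n < N" for n
    using that
  proof (induction n)
    case (Suc n)
    have "c (Suc n) * Q (Suc n) * \<tau> (Suc n) = (c (Suc n) * \<tau> (Suc n)) * Q (Suc n)"
      by (simp only: mult_ac)
    also have "\<dots> = - c n * (\<sigma> n * Q (Suc n))"
      unfolding c(2) by simp
    also have "\<dots> = c n * Q n * \<tau> (Suc n)"
      unfolding rec[OF Suc.prems] by simp
    finally show ?case using Suc nz by simp
  qed (simp add: c)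
  have "of_nat n * m * Q 0 = \<tau> 0 * P 0 - c n * \<tau> n * P n" if "n \<le> N" for n
    using that
  proof (induction n)
    case (Suc n)
    have "of_nat (Suc n) * m * Q 0 = of_nat n * m * Q 0 + m * (c n * Q n)"
      using const[of n] Suc.prems by (simp add: algebra_simps)
    also have "\<dots> = \<tau> 0 * P 0 - c n * \<tau> n * P n + c n * (m * Q n)"
      using Suc by simp
    also have "\<dots> = \<tau> 0 * P 0 + c n * \<sigma> n * P (Suc n)"
      using Suc.prems by (simp add: eq algebra_simps)
    also have "c n * \<sigma> n = - (c (Suc n) * \<tau> (Suc n))" unfolding c(2) by simp
    finally show ?case by simp
  qed (simp add: c)
  then show ?thesis by (simp add: c_def)
qed

section \<open>Eigenoperators of the commutator with the Hamiltonian\<close>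

lemma phase_commutes_iff:
  "phase a (Some W) = phase (Some W) a \<longleftrightarrow> a = None \<or> a = Some W"
  by (cases a rule: pauli_option_cases; cases W; simp add: complex_eq_iff)

lemma phase_swap: "phase b a = phase a b \<or> phase b a = - phase a b"
  by (cases a rule: pauli_option_cases; cases b rule: pauli_option_cases; simp)

text \<open>From here on only coefficients are used. \<open>coeff_eq\<close> is the eigenoperator
  equation at the product \<open>B\<close>, \<open>arc\<close> bounds the width of the products that
  occur by \<open>k\<close> in every direction, and \<open>k_le\<close> lets offsets of size about
  \<open>k\<close> be compared without wrapping.\<close>

locale eigenoperator =
  fixes hc q :: "(('l::nontriv, 'd::finite) site \<rightharpoonup> pauli) \<Rightarrow> complex"
    and J :: "pauli \<Rightarrow> complex" and k :: nat and \<mu> :: complex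
  assumes k_ge_2: "2 \<le> k" and k_le: "2 * k \<le> CARD('l)"
    and J_neq_0: "J PX \<noteq> 0" "J PY \<noteq> 0"
    and arc: "\<And>A \<alpha>. q A \<noteq> 0 \<Longrightarrow> \<exists>a. \<forall>s\<in>dom A. cval (s $ \<alpha> - a) < k"
    and hc_bond: "\<And>u v W. nearest_neighbours u v \<Longrightarrow> hc (bond u v W) = - J W"
    and hc_cases: "\<And>G. hc G \<noteq> 0 \<Longrightarrow>
      (\<exists>u P. G = [u \<mapsto> P]) \<or> (\<exists>u v W. nearest_neighbours u v \<and> G = bond u v W)"
    and coeff_eq: "\<And>B. \<mu> * q B = (\<Sum>G\<in>UNIV. hc G * kappa G (bmul G B) * q (bmul G B))"
begin

text \<open>The contribution to the coefficient at \<open>B\<close> of the term \<open>G\<close>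
  acting on the unique source \<open>bmul G B\<close>.\<close>

definition contrib :: "(('l, 'd) site \<rightharpoonup> pauli) \<Rightarrow> (('l, 'd) site \<rightharpoonup> pauli) \<Rightarrow> complex" where
  "contrib G B = hc G * kappa G (bmul G B) * q (bmul G B)"

lemma contrib_neq_0D:
  "contrib G B \<noteq> 0 \<Longrightarrow> hc G \<noteq> 0" "contrib G B \<noteq> 0 \<Longrightarrow> kappa G (bmul G B) \<noteq> 0"
  "contrib G B \<noteq> 0 \<Longrightarrow> q (bmul G B) \<noteq> 0"
  by (auto simp: contrib_def)

lemma coeff_eq_sum:
  assumes "\<And>G. contrib G B \<noteq> 0 \<Longrightarrow> G \<in> T"
  shows "\<mu> * q B = (\<Sum>G\<in>T. contrib G B)"
proof -
  have "\<mu> * q B = (\<Sum>G\<in>UNIV. contrib G B)"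
    by (simp add: coeff_eq contrib_def)
  also have "\<dots> = (\<Sum>G\<in>T. contrib G B)"
    by (rule sum.mono_neutral_right) (use assms in auto)
  finally show ?thesis .
qed

lemma card_gt: "k + 1 < CARD('l)" "3 < CARD('l)" "k < CARD('l)"
  using k_ge_2 k_le by auto

text \<open>A term that creates the site \<open>v\<close> of \<open>B\<close> cannot be a field,
  which would act on an identity and commute. It is a bond at \<open>v\<close>, and it fails to
  commute only if its other end meets an anticommuting letter of the source; so that end stays in
  the support.\<close>

lemma removal:
  assumes "hc G \<noteq> 0" "kappa G (bmul G B) \<noteq> 0" "v \<in> dom B" "v \<notin> dom (bmul G B)"
  obtains s W where "nearest_neighbours v s" "G = bond v s W" "B v = Some W" "B s \<noteq> None"
    "B s \<noteq> Some W" "dom (bmul G B) = dom B - {v}"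
proof -
  have Gv: "G v = B v" using assms(4) by (simp add: bmul_apply domIff)
  from hc_cases[OF assms(1)] show thesis
  proof (elim disjE exE conjE)
    fix u P assume G: "G = [u \<mapsto> P]"
    with Gv assms(3) have "v = u" by (auto split: if_splits)
    then have "bmul G B u = None" using assms(4) by auto
    then have "kappa G (bmul G B) = 0" unfolding G kappa_site by (simp add: G)
    with assms(2) show thesis by simp
  next
    fix u w W assume nn: "nearest_neighbours u w" and G: "G = bond u w W"
    then have "v = u \<or> v = w" using Gv assms(3) by (auto simp: bond_apply split: if_splits)
    then obtain s where G': "G = bond v s W" and nn': "nearest_neighbours v s"
      using nn G by (metis bond_commute nearest_neighbours_commute)
    have vs: "v \<noteq> s" using nn' by (rule nearest_neighbours_irrefl)
    let ?A = "bmul G B"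
    have Av: "?A v = None" using assms(4) by auto
    have As: "?A s = pmul (Some W) (B s)" by (simp add: bmul_apply G' bond_apply)
    \<comment> \<open>At \<open>v\<close> the source is the identity, so the noncommutation must
      come from \<open>s\<close>.\<close>
    have "phase (Some W) (?A s) \<noteq> phase (?A s) (Some W)"
      using assms(2) kappa_bond[OF vs, of W ?A] Av unfolding G'[symmetric] by simp
    then have *: "?A s \<noteq> None" "?A s \<noteq> Some W" by (metis phase_commutes_iff)+
    then have Bs: "B s \<noteq> None" "B s \<noteq> Some W" unfolding As by (cases "B s"; auto)+
    have "x \<in> dom ?A \<longleftrightarrow> x \<in> dom B - {v}" for x
      using Gv Bs unfolding in_dom_bmul G' by (cases "B x") (auto simp: bond_apply)
    then have "dom ?A = dom B - {v}" by blast
    moreover have "B v = Some W" using Gv by (simp add: G' bond_apply)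
    ultimately show thesis using that nn' G' Bs by blast
  qed
qed

text \<open>If the support did not change, the source would anticommute with \<open>W\<close> at
  both ends of the bond; the two signs cancel, so the bond would commute with it.\<close>

lemma dom_bmul_bond:
  assumes "u \<noteq> v" "kappa (bond u v W) (bmul (bond u v W) B) \<noteq> 0"
  shows "dom (bmul (bond u v W) B) \<noteq> dom B"
proof
  let ?A = "bmul (bond u v W) B"
  assume eq: "dom ?A = dom B"
  have A: "?A u = pmul (Some W) (B u)" "?A v = pmul (Some W) (B v)"
    by (simp_all add: bmul_apply bond_apply)
  have "?A u = None \<longleftrightarrow> B u = None" "?A v = None \<longleftrightarrow> B v = None"
    using eq by (metis domIff)+
  then have "\<not> (?A u = None \<or> ?A u = Some W)" "\<not> (?A v = None \<or> ?A v = Some W)"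
    unfolding A by (auto simp: eq_commute[of "Some W"])
      (metis pmul_None_right pmul_self(2) option.distinct(1))+
  then have "phase (?A u) (Some W) = - phase (Some W) (?A u)" "phase (?A v) (Some W) = - phase (Some W) (?A v)"
    by (metis phase_commutes_iff phase_swap)+
  then have "kappa (bond u v W) ?A = 0"
    using kappa_bond[OF assms(1), of W ?A] by simp
  then show False using assms(2) by simp
qed

text \<open>An arc of length \<open>k\<close> that contains offsets 0 and \<open>k - 1\<close>
  relative to \<open>u\<close> must start at \<open>u\<close>; \<open>k_le\<close> excludes that it
  wraps around instead.\<close>

lemma arc_ends:
  assumes "q A \<noteq> 0" "u \<in> dom A" "v \<in> dom A" "v $ \<alpha> = u $ \<alpha> + of_nat (k - 1)" "s \<in> dom A"
  shows "\<exists>i<k. s $ \<alpha> = u $ \<alpha> + of_nat i"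
proof -
  obtain a where a: "\<And>s. s \<in> dom A \<Longrightarrow> cval (s $ \<alpha> - a) < k" using arc[OF assms(1)] by blast
  have "v $ \<alpha> - a = (u $ \<alpha> - a) + of_nat (k - 1)" using assms(4) by simp
  then have "cval (v $ \<alpha> - a) = (cval (u $ \<alpha> - a) + (k - 1)) mod CARD('l)"
    by (metis cval_add_of_nat)
  also have "\<dots> = cval (u $ \<alpha> - a) + (k - 1)"
    using a[OF assms(2)] k_le by (intro mod_less) linarith
  finally have "cval (u $ \<alpha> - a) = 0" using a[OF assms(3)] by simp
  then have ua: "u $ \<alpha> = a" by (metis of_nat_cval of_nat_0 right_minus_eq)
  show ?thesis
    using a[OF assms(5)] unfolding ua by (metis add.commute diff_add_cancel of_nat_cval)
qed

text \<open>By \<open>k_le\<close> a difference of \<open>k\<close> cannot be undone by wrapping, so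
  it does not fit in an arc of length \<open>k\<close>.\<close>

lemma not_too_wide:
  assumes "q A \<noteq> 0" "u \<in> dom A" "v \<in> dom A"
  shows "v $ \<alpha> \<noteq> u $ \<alpha> + of_nat k"
proof
  assume v: "v $ \<alpha> = u $ \<alpha> + of_nat k"
  obtain a where a: "\<And>s. s \<in> dom A \<Longrightarrow> cval (s $ \<alpha> - a) < k" using arc[OF assms(1)] by blast
  have "v $ \<alpha> - a = (u $ \<alpha> - a) + of_nat k" using v by simp
  then have "cval (v $ \<alpha> - a) = (cval (u $ \<alpha> - a) + k) mod CARD('l)"
    by (metis cval_add_of_nat)
  also have "\<dots> = cval (u $ \<alpha> - a) + k"
    using a[OF assms(2)] k_le by (intro mod_less) linarith
  finally show False using a[OF assms(3)] by simp
qed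

lemma add_of_nat_eq_iff:
  "i < CARD('l) \<Longrightarrow> j < CARD('l) \<Longrightarrow> (a :: 'l mod_ring) + of_nat i = a + of_nat j \<longleftrightarrow> i = j"
  by (simp add: of_nat_mod_ring_eq_iff)

lemma of_nat_pred_k: "of_nat (k - Suc 0) + (1 :: 'l mod_ring) = of_nat k"
proof -
  have "k = Suc (k - Suc 0)" using k_ge_2 by simp
  then show ?thesis by (metis of_nat_Suc add.commute)
qed

text \<open>Appending a bond \<open>V\<close> beyond the right end makes a product that is too wide for \<open>Q\<close>, and the
  only other way to reach that product is to add a bond at the left end. So \<open>A\<close> must be a single
  site at its left end, and its coefficient is tied to that of its translate.\<close>

lemma step:
  assumes qA: "q A \<noteq> 0" and x: "x \<in> dom A" and u: "u \<in> dom A"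
    and ux: "u $ \<alpha> = x $ \<alpha> + of_nat (k - 1)" and V: "A u \<noteq> Some V" "J V \<noteq> 0"
    and B: "B = bmul (bond u (shift \<alpha> 1 u) V) A"
  obtains W A' where "B x = Some W" "B (shift \<alpha> 1 x) \<noteq> Some W"
    "A' = bmul (bond x (shift \<alpha> 1 x) W) B" "q A' \<noteq> 0"
    "dom A' = insert (shift \<alpha> 1 u) (dom A) - {x}"
    "\<And>s. s \<in> dom A \<Longrightarrow> s $ \<alpha> = x $ \<alpha> \<Longrightarrow> s = x"
    "J V * kappa (bond u (shift \<alpha> 1 u) V) A * q A
      + J W * kappa (bond x (shift \<alpha> 1 x) W) A' * q A' = 0"
proof -
  define a where "a = x $ \<alpha>"
  define u' where "u' = shift \<alpha> 1 u"
  define x' where "x' = shift \<alpha> 1 x"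
  define G0 where "G0 = bond u u' V"
  note L = card_gt
  have slices: "\<exists>i<k. s $ \<alpha> = a + of_nat i" if "s \<in> dom A" for s
    using arc_ends[OF qA x u ux that] by (simp add: a_def)
  have neq: "a + of_nat i = a + of_nat j \<longleftrightarrow> i = j" if "i \<le> k + 1" "j \<le> k + 1" for i j
    by (rule add_of_nat_eq_iff) (use that L in auto)
  have u'a: "u' $ \<alpha> = a + of_nat k"
    using of_nat_pred_k by (simp add: u'_def shift_nth ux a_def add.assoc)
  have u'A: "u' \<notin> dom A"
  proof
    assume "u' \<in> dom A"
    then obtain i where "i < k" "a + of_nat k = a + of_nat i" using slices u'a by metis
    then show False using neq[of k i] by simp
  qed
  have uu': "u \<noteq> u'" using u u'A by auto
  have B': "B = bmul G0 A" by (simp add: B G0_def u'_def)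
  have A: "A = bmul G0 B" by (simp add: B')
  have Bs: "B s = A s" if "s \<noteq> u" "s \<noteq> u'" for s
    using that by (simp add: B' bmul_apply G0_def bond_apply)
  have Bu: "B u = pmul (Some V) (A u)" "B u \<noteq> None"
    using V by (auto simp: B' bmul_apply G0_def bond_apply eq_commute[of "Some V"])
  have Bu': "B u' = Some V"
    using u'A by (simp add: B' bmul_apply G0_def bond_apply domIff)
  have "s \<in> dom B \<longleftrightarrow> s \<in> insert u' (dom A)" for s
    using V(1) u u'A unfolding B' in_dom_bmul by (auto simp: G0_def bond_apply)
  then have domB: "dom B = insert u' (dom A)" by blast
  have posB: "\<exists>i\<le>k. s $ \<alpha> = a + of_nat i" if "s \<in> dom B" for s
    using that slices[of s] u'a unfolding domB by (auto intro: less_imp_le)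
  have topB: "s = u'" if "s \<in> dom B" "s $ \<alpha> = a + of_nat k" for s
    using that slices[of s] neq unfolding domB by (metis insertE less_imp_le less_irrefl trans_le_add1 order_refl)
  have xu: "x \<noteq> u"
  proof
    assume "x = u"
    then have "a + of_nat 0 = a + of_nat (k - 1)" using ux by (simp add: a_def)
    with neq[of 0 "k - 1"] k_ge_2 show False by simp
  qed
  have xu': "x \<noteq> u'" using x u'A by auto
  have x'u': "x' \<noteq> u'" using xu by (simp add: x'_def u'_def shift_inj_site)
  have xx': "x \<noteq> x'" using L by (simp add: x'_def)
  have Bx: "B x = A x" by (rule Bs[OF xu xu'])
  \<comment> \<open>\<open>B\<close> contains \<open>x\<close> and \<open>u'\<close>, which lie
    \<open>k\<close> apart along \<alpha>.\<close>
  have q0: "q B = 0"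
    using not_too_wide[of B x u' \<alpha>] x unfolding domB u'a a_def by blast
  have nn0: "nearest_neighbours u u'" by (simp add: u'_def)
  \<comment> \<open>Any contributing term other than \<open>G0\<close> leaves \<open>u'\<close> in
    place, because only \<open>G0\<close> can remove it. Then its source must have no site in the
    slice of \<open>x\<close>, so the term removes \<open>x\<close>.\<close>
  have other: "G = bond x x' W \<and> B x = Some W \<and> B x' \<noteq> None \<and> B x' \<noteq> Some W
      \<and> dom (bmul G B) = dom B - {x} \<and> (\<forall>s\<in>dom A. s $ \<alpha> = a \<longrightarrow> s = x)"
    if G: "contrib G B \<noteq> 0" "G \<noteq> G0" and W: "B x = Some W" for G W
  proof -
    note G' = contrib_neq_0D[OF G(1)]
    have "u' \<in> dom (bmul G B)"
    proof (rule ccontr)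
      assume gone: "u' \<notin> dom (bmul G B)"
      have "u' \<in> dom B" using domB by simp
      from removal[OF G'(1,2) this gone] obtain s W where
        s: "nearest_neighbours u' s" "G = bond u' s W" "B u' = Some W" "B s \<noteq> None"
        by metis
      have su': "s \<noteq> u'" using s(1) nearest_neighbours_irrefl by blast
      have sB: "s \<in> dom B" using s(4) by auto
      from s(1) have "s = u"
      proof (cases rule: neighbour_cases[where \<alpha> = \<alpha>])
        case same
        then show ?thesis using topB[OF sB] su' u'a by simp
      next
        case up
        then have "s $ \<alpha> = a + of_nat (k + 1)" by (simp add: shift_nth u'a algebra_simps)
        moreover obtain i where i: "i \<le> k" "s $ \<alpha> = a + of_nat i" using posB[OF sB] by auto
        ultimately have "i = k + 1" using neq[of i "k + 1"] by simp
        then show ?thesis using i(1) by simp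
      next
        case down
        then show ?thesis by (simp add: u'_def shift_inj_site)
      qed
      then have "G = G0" using s(2,3) Bu' by (simp add: G0_def bond_commute)
      with G(2) show False by simp
    qed
    then have gone: "s \<notin> dom (bmul G B)" if "s $ \<alpha> = a" for s
      using not_too_wide[OF G'(3), of s u' \<alpha>] that u'a by auto
    have dA: "s \<in> dom B" if "s \<in> dom A" for s using that domB by simp
    from removal[OF G'(1,2) _ gone[of x]] dA[OF x] obtain s W2 where
      s: "nearest_neighbours x s" "G = bond x s W2" "B x = Some W2" "B s \<noteq> None" "B s \<noteq> Some W2"
        "dom (bmul G B) = dom B - {x}" by (auto simp: a_def)
    have sx: "s \<noteq> x" using s(1) nearest_neighbours_irrefl by blast
    have sB: "s \<in> dom B" using s(4) by auto
    \<comment> \<open>The whole slice of \<open>x\<close> has to disappear, but a bond removing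
      \<open>x\<close> takes away no other site.\<close>
    have uniq: "t = x" if "t \<in> dom B" "t $ \<alpha> = a" for t
      using gone[OF that(2)] that(1) s(6) by auto
    from s(1) have "s = x'"
    proof (cases rule: neighbour_cases[where \<alpha> = \<alpha>])
      case same
      then show ?thesis using uniq[OF sB] sx by (simp add: a_def)
    next
      case up
      then show ?thesis by (simp add: x'_def)
    next
      \<comment> \<open>A neighbour behind \<open>x\<close> would have offset
        \<open>CARD('l) - 1\<close>, beyond the last slice \<open>k\<close> of
        \<open>B\<close>.\<close>
      case down
      then have "s = shift \<alpha> (CARD('l) - 1) x" by (simp only: shift_diff_eq)
      then have sa: "s $ \<alpha> = a + of_nat (CARD('l) - 1)" by (simp add: shift_nth a_def)
      obtain i where "i \<le> k" "s $ \<alpha> = a + of_nat i" using posB[OF sB] by auto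
      then have "i = CARD('l) - 1"
        unfolding sa using L by (subst (asm) add_of_nat_eq_iff) auto
      then show ?thesis using \<open>i \<le> k\<close> L by linarith
    qed
    then show ?thesis using s W uniq dA by auto
  qed
  obtain W where W: "B x = Some W" using Bx x by auto
  have c0: "contrib G0 B = - J V * kappa G0 A * q A"
    by (simp only: contrib_def A[symmetric]) (simp only: hc_bond[OF nn0] G0_def)
  have "kappa G0 A \<noteq> 0"
  proof -
    have "A u' = None" using u'A by auto
    then have "kappa G0 A = phase (Some V) (A u) - phase (A u) (Some V)"
      unfolding G0_def kappa_bond[OF uu'] by simp
    moreover have "phase (A u) (Some V) \<noteq> phase (Some V) (A u)"
      unfolding phase_commutes_iff using V(1) u by auto
    ultimately show ?thesis by simp
  qed
  then have c0n: "contrib G0 B \<noteq> 0" using c0 V qA by simp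
  define G1 where "G1 = bond x x' W"
  have "G0 \<noteq> G1"
    unfolding G0_def G1_def by (subst bond_eq_iff) (use xx' xu xu' in auto)
  have "\<mu> * q B = (\<Sum>G\<in>{G0, G1}. contrib G B)"
    by (rule coeff_eq_sum) (use other[OF _ _ W] G1_def in blast)
  then have sum0: "contrib G0 B + contrib G1 B = 0"
    using \<open>G0 \<noteq> G1\<close> q0 by simp
  \<comment> \<open>The two contributions add up to \<open>\<mu> * q B = 0\<close> and the one of
    \<open>G0\<close> is nonzero, so the bond at the left end really contributes.\<close>
  then have c1n: "contrib G1 B \<noteq> 0" using c0n by auto
  note o = other[OF c1n \<open>G0 \<noteq> G1\<close>[symmetric] W]
  define A' where "A' = bmul G1 B"
  have "nearest_neighbours x x'" by (simp add: x'_def)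
  then have c1: "contrib G1 B = - J W * kappa G1 A' * q A'"
    by (simp only: contrib_def hc_bond G1_def A'_def)
  show thesis
  proof (rule that[of W A'])
    show "B x = Some W" by (rule W)
    show "B (shift \<alpha> 1 x) \<noteq> Some W" using o by (simp add: x'_def)
    show "A' = bmul (bond x (shift \<alpha> 1 x) W) B" by (simp add: A'_def G1_def x'_def)
    show "q A' \<noteq> 0" using contrib_neq_0D(3)[OF c1n] by (simp add: A'_def)
    show "dom A' = insert (shift \<alpha> 1 u) (dom A) - {x}" using o domB unfolding A'_def u'_def by metis
    show "\<And>s. s \<in> dom A \<Longrightarrow> s $ \<alpha> = x $ \<alpha> \<Longrightarrow> s = x" using o by (simp add: a_def)
    have "J V * kappa G0 A * q A + J W * kappa G1 A' * q A' = 0"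
      using sum0 c0 c1 by (metis add_uminus_conv_diff minus_add_distrib minus_mult_left neg_equal_0_iff_equal)
    then show "J V * kappa (bond u (shift \<alpha> 1 u) V) A * q A
      + J W * kappa (bond x (shift \<alpha> 1 x) W) A' * q A' = 0"
      by (simp add: G0_def G1_def u'_def x'_def)
  qed
qed

section \<open>Products of full width are straight segments\<close>

lemma other_letter: "\<exists>V. J V \<noteq> 0 \<and> a \<noteq> Some V"
  using J_neq_0 by (metis option.inject pauli.distinct(1))

text \<open>\<open>step\<close> shows that the first slice is a single site. After one step the
  slice \<open>Suc i\<close> of \<open>A\<close> has become the slice \<open>i\<close> of
  \<open>A'\<close>, so the induction reads off the slices one by one; each new left end is the
  \<alpha>-neighbour of the old one.\<close>

lemma straight_aux:
  assumes "q A \<noteq> 0" "x \<in> dom A" "u \<in> dom A" "u $ \<alpha> = x $ \<alpha> + of_nat (k - 1)" "i < k"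
  shows "shift \<alpha> i x \<in> dom A \<and> (\<forall>s\<in>dom A. s $ \<alpha> = x $ \<alpha> + of_nat i \<longrightarrow> s = shift \<alpha> i x)"
  using assms
proof (induction i arbitrary: A x u)
  case 0
  obtain V where V: "A u \<noteq> Some V" "J V \<noteq> 0" using other_letter[of "A u"] by auto
  show ?case by (rule step[OF 0(1-4) V refl]) (use 0 in auto)
next
  case (Suc i)
  obtain V where V: "A u \<noteq> Some V" "J V \<noteq> 0" using other_letter[of "A u"] by auto
  let ?x = "shift \<alpha> 1 x" and ?u = "shift \<alpha> 1 u"
  have L: "k < CARD('l)" "1 < CARD('l)" using card_gt by auto
  have xu: "x \<noteq> u"
  proof
    assume "x = u"
    then have "x $ \<alpha> + of_nat 0 = x $ \<alpha> + of_nat (k - 1)" using Suc.prems(4) by simp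
    then show False using L k_ge_2 by (subst (asm) add_of_nat_eq_iff) auto
  qed
  obtain W A' where A': "bmul (bond u ?u V) A x = Some W"
    "bmul (bond u ?u V) A ?x \<noteq> Some W"
    "A' = bmul (bond x ?x W) (bmul (bond u ?u V) A)" "q A' \<noteq> 0"
    "dom A' = insert ?u (dom A) - {x}"
    by (rule step[OF Suc.prems(1-4) V refl]) blast
  have u': "?u \<in> dom A'"
  proof -
    have "?u \<noteq> x"
    proof
      assume "?u = x"
      have "?u $ \<alpha> = x $ \<alpha> + of_nat k"
        using Suc.prems(4) of_nat_pred_k by (simp add: shift_nth add.assoc)
      then have "x $ \<alpha> + of_nat k = x $ \<alpha> + of_nat 0"
        using \<open>?u = x\<close> by simp
      then show False using L k_ge_2 by (subst (asm) add_of_nat_eq_iff) auto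
    qed
    then show ?thesis using A'(5) by simp
  qed
  have x': "?x \<in> dom A'"
    using A'(2) unfolding A'(3) in_dom_bmul by (simp add: bond_apply)
  have "?u $ \<alpha> = ?x $ \<alpha> + of_nat (k - 1)"
    using Suc.prems(4) by (simp add: shift_nth)
  then have IH: "shift \<alpha> i ?x \<in> dom A' \<and>
      (\<forall>s\<in>dom A'. s $ \<alpha> = ?x $ \<alpha> + of_nat i \<longrightarrow> s = shift \<alpha> i ?x)"
    using Suc.IH[OF A'(4) x' u'] Suc.prems(5) by simp
  have coord: "?x $ \<alpha> + of_nat i = x $ \<alpha> + of_nat (Suc i)" by (simp add: shift_nth)
  \<comment> \<open>The added site \<open>?u\<close> and the removed site \<open>x\<close> lie
    outside this slice, so it is the same for \<open>A\<close> and \<open>A'\<close>.\<close>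
  have "shift \<alpha> (Suc i) x \<noteq> ?u"
  proof
    assume "shift \<alpha> (Suc i) x = ?u"
    then have "shift \<alpha> (Suc i) x $ \<alpha> = ?u $ \<alpha>" by simp
    then have "x $ \<alpha> + of_nat i = x $ \<alpha> + of_nat (k - 1)"
      using Suc.prems(4) by (simp add: shift_nth)
    then show False using L Suc.prems(5) by (subst (asm) add_of_nat_eq_iff) auto
  qed
  moreover have "s \<noteq> x" if "s $ \<alpha> = x $ \<alpha> + of_nat (Suc i)" for s
  proof
    assume "s = x"
    then have "x $ \<alpha> + of_nat (Suc i) = x $ \<alpha> + of_nat 0" using that by simp
    then show False using L Suc.prems(5) by (subst (asm) add_of_nat_eq_iff) auto
  qed
  ultimately show ?case
    using IH unfolding A'(5) coord by auto
qed

lemma straight: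
  assumes "q A \<noteq> 0" "x \<in> dom A" "u \<in> dom A" "u $ \<alpha> = x $ \<alpha> + of_nat (k - 1)"
  shows "dom A = line \<alpha> k x"
proof
  show "line \<alpha> k x \<subseteq> dom A"
    using straight_aux[OF assms] by (auto simp: line_def)
  show "dom A \<subseteq> line \<alpha> k x"
    using straight_aux[OF assms] arc_ends[OF assms] unfolding line_def by blast
qed

section \<open>Translating strings\<close>

text \<open>Coupling and commutator sign of an end bond always enter the equations in this
  combination.\<close>

definition sJ :: "bool \<Rightarrow> complex" where
  "sJ b = sgb b * J (xy b)"

lemma sJ_neq_0: "sJ b \<noteq> 0"
  using J_neq_0 by (simp add: sJ_def sgb_def xy_def)

lemma kappa_remove:
  assumes "A x = None" "A y = Some (xy (\<not> b))" "x \<noteq> y"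
  shows "kappa (bond x y (xy b)) A = 2 * \<i> * sgb b"
  using assms by (simp add: kappa_bond)

text \<open>Apply \<open>step\<close> with the letter opposite to \<open>b'\<close>. The wide
  product is the string of length \<open>k + 1\<close> with ends \<open>b\<close> and
  \<open>\<not> b'\<close>; cutting its right end gives back the string, cutting its left end gives
  the translate with both letters flipped.\<close>

lemma string_shift:
  assumes "q (str \<alpha> k x b b') \<noteq> 0"
  shows "q (str \<alpha> k (shift \<alpha> 1 x) (\<not> b) (\<not> b')) \<noteq> 0"
    "sJ b * q (str \<alpha> k (shift \<alpha> 1 x) (\<not> b) (\<not> b')) = - sJ (\<not> b') * q (str \<alpha> k x b b')"
proof -
  define u where "u = shift \<alpha> (k - 1) x"
  define A where "A = str \<alpha> k x b b'"
  define B where "B = str \<alpha> (k + 1) x b (\<not> b')"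
  note L = k_ge_2 card_gt
  have us: "shift \<alpha> 1 u = shift \<alpha> k x" using L by (simp add: u_def)
  have BA: "bmul (bond (shift \<alpha> 1 u) u (xy (\<not> b'))) B = A"
    using bond_str_right[of "k + 1" \<alpha> x "\<not> b'" b] L
    by (simp add: us u_def A_def B_def numeral_2_eq_2)
  then have B: "B = bmul (bond u (shift \<alpha> 1 u) (xy (\<not> b'))) A"
    by (metis bmul_self bond_commute)
  have Au: "A u = Some (xy b')" using L by (simp add: A_def u_def str_shift)
  have Au': "A (shift \<alpha> 1 u) = None" unfolding us using L by (simp add: A_def str_shift)
  have "x \<in> line \<alpha> k x" using shift_in_line[of 0 k \<alpha> x] L by simp
  moreover have "u \<in> line \<alpha> k x" using L by (simp add: u_def)
  ultimately obtain W A' where W: "B x = Some W" "A' = bmul (bond x (shift \<alpha> 1 x) W) B" "q A' \<noteq> 0"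
    and eq: "J (xy (\<not> b')) * kappa (bond u (shift \<alpha> 1 u) (xy (\<not> b'))) A * q A
      + J W * kappa (bond x (shift \<alpha> 1 x) W) A' * q A' = 0"
    by (rule_tac step[of A x u \<alpha> "xy (\<not> b')" B])
      (use assms J_neq_0 Au B in \<open>auto simp: A_def u_def shift_nth xy_def\<close>)
  have "B x = Some (xy b)" using L by (simp add: B_def str_first)
  then have Wb: "W = xy b" using W(1) by simp
  have A': "A' = str \<alpha> k (shift \<alpha> 1 x) (\<not> b) (\<not> b')"
    using bond_str_left[of "k + 1" x \<alpha> b "\<not> b'"] L by (simp add: W(2) Wb B_def)
  then show "q (str \<alpha> k (shift \<alpha> 1 x) (\<not> b) (\<not> b')) \<noteq> 0" using W(3) by simp
  have "kappa (bond u (shift \<alpha> 1 u) (xy (\<not> b'))) A = 2 * \<i> * sgb (\<not> b')"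
    unfolding bond_commute[of u] by (rule kappa_remove) (use Au Au' L in auto)
  moreover have "kappa (bond x (shift \<alpha> 1 x) W) A' = 2 * \<i> * sgb b"
    unfolding Wb
  proof (rule kappa_remove)
    show "A' x = None" using W(1) by (simp add: W(2) bmul_apply bond_apply)
    show "A' (shift \<alpha> 1 x) = Some (xy (\<not> b))" using L by (simp add: A' str_first)
  qed (use L in simp)
  ultimately have "2 * \<i> * (sJ (\<not> b') * q A + sJ b * q A') = 0"
    using eq unfolding Wb by (simp add: sJ_def algebra_simps)
  then have "sJ (\<not> b') * q A + sJ b * q A' = 0" by simp
  then show "sJ b * q (str \<alpha> k (shift \<alpha> 1 x) (\<not> b) (\<not> b')) = - sJ (\<not> b') * q (str \<alpha> k x b b')"
    unfolding A'[symmetric] A_def[symmetric] by (simp add: add_eq_0_iff)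
qed

section \<open>Reduction to strings with Z in the interior\<close>

abbreviation is_xy :: "pauli option \<Rightarrow> bool" where
  "is_xy a \<equiv> a = Some PX \<or> a = Some PY"

text \<open>One step for arbitrary letters. It creates a new right end X or Y, turns an old right
  end X or Y into Z, and keeps the interior; \<open>chi\<close> survives because only bonds are
  multiplied.\<close>

lemma advance:
  assumes qA: "q A \<noteq> 0" and dA: "dom A = line \<alpha> k x"
  obtains A' where "q A' \<noteq> 0" "dom A' = line \<alpha> k (shift \<alpha> 1 x)" "\<And>P. chi P A' = chi P A"
    "is_xy (A' (shift \<alpha> k x))"
    "\<And>i. 2 \<le> i \<Longrightarrow> i < k - 1 \<Longrightarrow> A' (shift \<alpha> i x) = A (shift \<alpha> i x)"
    "3 \<le> k \<Longrightarrow> is_xy (A (shift \<alpha> (k - 1) x)) \<Longrightarrow> A' (shift \<alpha> (k - 1) x) = Some PZ"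
    "k = 2 \<Longrightarrow> is_xy (A (shift \<alpha> 1 x)) \<Longrightarrow> is_xy (A' (shift \<alpha> 1 x))"
    "3 \<le> k \<Longrightarrow> A (shift \<alpha> 1 x) = Some PZ \<Longrightarrow> is_xy (A' (shift \<alpha> 1 x))"
proof -
  define u where "u = shift \<alpha> (k - 1) x"
  define x' where "x' = shift \<alpha> 1 x"
  note L = k_ge_2 card_gt
  have us: "shift \<alpha> 1 u = shift \<alpha> k x" using L by (simp add: u_def)
  \<comment> \<open>This choice makes the old end letter Z whenever it is X or Y.\<close>
  define V where "V = (if A u = Some PX then PY else PX)"
  have V: "A u \<noteq> Some V" "J V \<noteq> 0" "V = PX \<or> V = PY" "is_xy (A u) \<Longrightarrow> pmul (Some V) (A u) = Some PZ"
    using J_neq_0 by (auto simp: V_def)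
  define B where "B = bmul (bond u (shift \<alpha> 1 u) V) A"
  have x: "x \<in> dom A" using shift_in_line[of 0 k \<alpha> x] L by (simp add: dA)
  have u: "u \<in> dom A" using L by (simp add: dA u_def)
  have ux: "u $ \<alpha> = x $ \<alpha> + of_nat (k - 1)" by (simp add: u_def shift_nth)
  from step[OF qA x u ux V(1,2) B_def] obtain W A' where W: "B x = Some W"
    "B x' \<noteq> Some W" "A' = bmul (bond x x' W) B" "q A' \<noteq> 0"
    "dom A' = insert (shift \<alpha> 1 u) (dom A) - {x}" unfolding x'_def by metis
  have neq: "shift \<alpha> i x = shift \<alpha> j x \<longleftrightarrow> i = j" if "i \<le> k" "j \<le> k" for i j
    using that L by simp
  have B: "B (shift \<alpha> i x) = (if i = k then Some V else if i = k - 1 then pmul (Some V) (A u) else A (shift \<alpha> i x))"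
    if "i \<le> k" for i
  proof -
    have "shift \<alpha> k x \<notin> dom A" unfolding dA using L by simp
    then have "A (shift \<alpha> k x) = None" by (simp add: domIff)
    then show ?thesis
      using neq[OF that, of k] neq[OF that, of "k - 1"] L us
      unfolding B_def bmul_apply bond_apply by (auto simp: u_def)
  qed
  have A': "A' (shift \<alpha> i x) = B (shift \<alpha> i x)" if "2 \<le> i" "i \<le> k" for i
    using neq[of i 0] neq[of i 1] that by (simp add: W(3) bmul_apply bond_apply x'_def)
  have A'x': "A' x' = pmul (Some W) (B x')" "A' x' \<noteq> None"
    using W(2) by (auto simp: W(3) bmul_apply bond_apply)
  have Bx': "B x' = (if k = 2 then pmul (Some V) (A u) else A x')"
    using B[of 1] L by (auto simp: x'_def)
  \<comment> \<open>The bond letter \<open>W\<close> differs from Z here, so it is X or Y, and its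
    product with Z is the other one.\<close>
  have xyZ: "is_xy (A' x')" if "B x' = Some PZ"
    using A'x' that W(2) by (cases W) auto
  show thesis
  proof (rule that[of A'])
    show "q A' \<noteq> 0" by (rule W(4))
    show "dom A' = line \<alpha> k (shift \<alpha> 1 x)"
      using line_shift[of k \<alpha> x] L unfolding W(5) us dA by simp
    have "u \<noteq> shift \<alpha> 1 u" "x \<noteq> x'" using L by (auto simp: x'_def)
    then show "chi P A' = chi P A" for P
      by (simp add: W(3) B_def chi_bmul chi_bond)
    show "is_xy (A' (shift \<alpha> k x))" using A'[of k] B[of k] V(3) L by auto
    show "A' (shift \<alpha> i x) = A (shift \<alpha> i x)" if "2 \<le> i" "i < k - 1" for i
    proof -
      have "i \<le> k" "i \<noteq> k" "i \<noteq> k - 1" using that by auto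
      then show ?thesis using A'[of i] B[of i] that by simp
    qed
    show "A' (shift \<alpha> (k - 1) x) = Some PZ" if "3 \<le> k" "is_xy (A (shift \<alpha> (k - 1) x))"
    proof -
      have "2 \<le> k - 1" "k - 1 \<le> k" "k - 1 \<noteq> k" using that by auto
      then show ?thesis using A'[of "k - 1"] B[of "k - 1"] that V(4) by (simp add: u_def)
    qed
    show "is_xy (A' (shift \<alpha> 1 x))" if "k = 2" "is_xy (A (shift \<alpha> 1 x))"
      using xyZ Bx' V(4) that by (simp add: u_def x'_def)
    show "is_xy (A' (shift \<alpha> 1 x))" if "3 \<le> k" "A (shift \<alpha> 1 x) = Some PZ"
      using xyZ Bx' that by (simp add: x'_def)
  qed
qed

text \<open>From the second step on, each step adds one Z just before the right end. After
  \<open>n\<close> steps, with \<open>1 \<le> n\<close>, the interior positions counted from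
  \<open>y\<close> that satisfy \<open>k \<le> i + n\<close> are Z.\<close>

lemma advance_iterated:
  assumes "q A \<noteq> 0" "dom A = line \<alpha> k x"
  shows "\<exists>A' y. q A' \<noteq> 0 \<and> dom A' = line \<alpha> k y \<and> (\<forall>P. chi P A' = chi P A)
    \<and> (1 \<le> n \<longrightarrow> is_xy (A' (shift \<alpha> (k - 1) y)))
    \<and> (\<forall>i. 1 \<le> i \<and> i < k - 1 \<and> k \<le> i + n \<longrightarrow> A' (shift \<alpha> i y) = Some PZ)"
proof (induction n)
  case 0
  show ?case using assms by (intro exI[of _ A] exI[of _ x]) auto
next
  case (Suc n)
  then obtain A1 y where A1: "q A1 \<noteq> 0" "dom A1 = line \<alpha> k y" "\<And>P. chi P A1 = chi P A"
    "1 \<le> n \<Longrightarrow> is_xy (A1 (shift \<alpha> (k - 1) y))"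
    "\<And>i. 1 \<le> i \<Longrightarrow> i < k - 1 \<Longrightarrow> k \<le> i + n \<Longrightarrow> A1 (shift \<alpha> i y) = Some PZ" by blast
  obtain A' where A': "q A' \<noteq> 0" "dom A' = line \<alpha> k (shift \<alpha> 1 y)" "\<And>P. chi P A' = chi P A1"
    "is_xy (A' (shift \<alpha> k y))"
    "\<And>i. 2 \<le> i \<Longrightarrow> i < k - 1 \<Longrightarrow> A' (shift \<alpha> i y) = A1 (shift \<alpha> i y)"
    "3 \<le> k \<Longrightarrow> is_xy (A1 (shift \<alpha> (k - 1) y)) \<Longrightarrow> A' (shift \<alpha> (k - 1) y) = Some PZ"
    by (rule advance[OF A1(1,2)]) blast
  have "A' (shift \<alpha> i (shift \<alpha> 1 y)) = Some PZ" if i: "1 \<le> i" "i < k - 1" "k \<le> i + Suc n" for i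
  proof (cases "Suc i = k - 1")
    case True
    then have "1 \<le> n" "3 \<le> k" using i by auto
    from A'(6)[OF this(2) A1(4)[OF this(1)]] show ?thesis using True by simp
  next
    case False
    then show ?thesis using A'(5)[of "Suc i"] A1(5)[of "Suc i"] i by simp
  qed
  moreover have "is_xy (A' (shift \<alpha> (k - 1) (shift \<alpha> 1 y)))"
    using A'(4) k_ge_2 by simp
  ultimately show ?case
    using A'(1,2,3) A1(3) by (intro exI[of _ A'] exI[of _ "shift \<alpha> 1 y"]) auto
qed

lemma normal_form:
  assumes "q A \<noteq> 0" "dom A = line \<alpha> k x"
  obtains y b b' where "q (str \<alpha> k y b b') \<noteq> 0" "\<And>P. chi P (str \<alpha> k y b b') = chi P A"
proof -
  obtain A1 y where A1: "q A1 \<noteq> 0" "dom A1 = line \<alpha> k y" "\<And>P. chi P A1 = chi P A"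
    "is_xy (A1 (shift \<alpha> (k - 1) y))"
    "\<And>i. 1 \<le> i \<Longrightarrow> i < k - 1 \<Longrightarrow> A1 (shift \<alpha> i y) = Some PZ"
    using advance_iterated[OF assms, of k] k_ge_2 by auto
  \<comment> \<open>After \<open>k\<close> steps the interior is all Z. One further step makes the
    left end X or Y as well, since its new left end comes from a Z, or from the old right end if
    \<open>k = 2\<close>.\<close>
  obtain A' where A': "q A' \<noteq> 0" "dom A' = line \<alpha> k (shift \<alpha> 1 y)" "\<And>P. chi P A' = chi P A1"
    "is_xy (A' (shift \<alpha> k y))"
    "\<And>i. 2 \<le> i \<Longrightarrow> i < k - 1 \<Longrightarrow> A' (shift \<alpha> i y) = A1 (shift \<alpha> i y)"
    "3 \<le> k \<Longrightarrow> is_xy (A1 (shift \<alpha> (k - 1) y)) \<Longrightarrow> A' (shift \<alpha> (k - 1) y) = Some PZ"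
    "k = 2 \<Longrightarrow> is_xy (A1 (shift \<alpha> 1 y)) \<Longrightarrow> is_xy (A' (shift \<alpha> 1 y))"
    "3 \<le> k \<Longrightarrow> A1 (shift \<alpha> 1 y) = Some PZ \<Longrightarrow> is_xy (A' (shift \<alpha> 1 y))"
    by (rule advance[OF A1(1,2)]) blast
  have "is_xy (A' (shift \<alpha> 1 y))"
  proof (cases "k = 2")
    case True
    then show ?thesis using A'(7) A1(4) by simp
  next
    case False
    then show ?thesis using A'(8) A1(5)[of 1] k_ge_2 by simp
  qed
  then obtain b where b: "A' (shift \<alpha> 1 y) = Some (xy b)" using ex_xy by blast
  obtain b' where b': "A' (shift \<alpha> k y) = Some (xy b')" using ex_xy[OF A'(4)] by blast
  have "A' = str \<alpha> k (shift \<alpha> 1 y) b b'"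
  proof (rule str_eqI)
    show "A' (shift \<alpha> (k - 1) (shift \<alpha> 1 y)) = Some (xy b')" using b' k_ge_2 by simp
    show "A' (shift \<alpha> i (shift \<alpha> 1 y)) = Some PZ" if i: "1 \<le> i" "i < k - 1" for i
    proof (cases "Suc i = k - 1")
      case True
      then show ?thesis using A'(6) A1(4) i by simp
    next
      case False
      then show ?thesis using A'(5)[of "Suc i"] A1(5)[of "Suc i"] i by simp
    qed
  qed (use A'(2) b k_ge_2 k_le in auto)
  then show thesis using that A'(1,3) A1(3) by metis
qed

text \<open>\<open>b = even n\<close> is the letter \<open>b\<close> after \<open>n\<close>
  flips.\<close>

lemma string_shift_iterated:
  assumes "q (str \<alpha> k x b b') \<noteq> 0"
  shows "q (str \<alpha> k (shift \<alpha> n x) (b = even n) (b' = even n)) \<noteq> 0"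
    "sJ (b = even n) * q (str \<alpha> k (shift \<alpha> (Suc n) x) (b = even (Suc n)) (b' = even (Suc n)))
      = - sJ (b' = even (Suc n)) * q (str \<alpha> k (shift \<alpha> n x) (b = even n) (b' = even n))"
proof -
  have neg: "(\<not> (c = even n)) = (c = even (Suc n))" for c n by auto
  show *: "q (str \<alpha> k (shift \<alpha> n x) (b = even n) (b' = even n)) \<noteq> 0" for n
  proof (induction n)
    case (Suc n)
    from string_shift(1)[OF this] show ?case by (simp only: neg shift_shift) simp
  qed (use assms in simp)
  from string_shift(2)[OF *[of n]] show
    "sJ (b = even n) * q (str \<alpha> k (shift \<alpha> (Suc n) x) (b = even (Suc n)) (b' = even (Suc n)))
      = - sJ (b' = even (Suc n)) * q (str \<alpha> k (shift \<alpha> n x) (b = even n) (b' = even n))"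
    by (simp only: neg shift_shift) simp
qed

section \<open>Strings of improper parity\<close>

text \<open>A bond \<open>w w'\<close> attached to the side of a string gives a T-shaped product of the same width,
  which is not straight. Besides the string itself only its two truncations at the ends contribute,
  and a truncation drops out if \<open>w\<close> is next to the end and carries the same Pauli matrix as it.\<close>

lemma T_equation:
  fixes x :: "('l, 'd) site"
  assumes "\<beta> \<noteq> \<alpha>" "1 \<le> i" "i \<le> k - 2"
    and left: "i = 1 \<Longrightarrow> b = (\<not> t)" and right: "i = k - 2 \<Longrightarrow> b' = (\<not> t)"
  defines "w \<equiv> shift \<alpha> i x"
  defines "T \<equiv> bond w (shift \<beta> 1 w) (xy t)"
  shows "sJ t * q (str \<alpha> k x b b') =
      sJ b * (if i = 1 then 0 else q (bmul T (str \<alpha> (k - 1) (shift \<alpha> 1 x) (\<not> b) b')))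
    + sJ b' * (if i = k - 2 then 0 else q (bmul T (str \<alpha> (k - 1) x b (\<not> b'))))"
proof -
  note L = card_gt
  have k3: "3 \<le> k" using assms by auto
  define w' where "w' = shift \<beta> 1 w"
  define S where "S = str \<alpha> k x b b'"
  define B where "B = bmul T S"
  define x' where "x' = shift \<alpha> 1 x"
  define u where "u = shift \<alpha> (k - 1) x"
  define v where "v = shift \<alpha> (k - 2) x"
  have nth_\<beta>: "s $ \<beta> = x $ \<beta>" if "s \<in> line \<alpha> k x" for s
    using that assms(1) by (auto simp: line_def shift_nth)
  have wl: "w \<in> line \<alpha> k x" using assms L by (simp add: w_def)
  have w'\<beta>: "w' $ \<beta> = x $ \<beta> + 1" using nth_\<beta>[OF wl] by (simp add: w'_def shift_nth)
  have w'l: "w' \<notin> line \<alpha> k x" using nth_\<beta>[of w'] w'\<beta> by auto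
  have ww': "w \<noteq> w'" using wl w'l by auto
  have xl: "x \<in> line \<alpha> k x" using shift_in_line[of 0 k \<alpha> x] k3 L by simp
  have ul: "u \<in> line \<alpha> k x" using k3 L by (simp add: u_def)
  have T: "T = bond w w' (xy t)" by (simp add: T_def w'_def)
  have i: "i < k" "i \<noteq> 0" "i \<noteq> k - 1" using assms(2,3) k3 by linarith+
  have Sw: "S w = Some PZ" using i L k3 by (simp add: S_def w_def str_shift)
  have Sw': "S w' = None" using w'l by (simp add: S_def str_outside)
  have Bw: "B w = Some (xy (\<not> t))" and Bw': "B w' = Some (xy t)"
    by (simp_all add: B_def T bmul_apply bond_apply Sw Sw')
  have Bs: "B s = S s" if "s \<noteq> w" "s \<noteq> w'" for s
    using that by (simp add: B_def T bmul_apply bond_apply)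
  have domB: "dom B = insert w' (line \<alpha> k x)"
  proof -
    have "s \<in> dom B \<longleftrightarrow> s \<in> insert w' (line \<alpha> k x)" for s
    proof (cases "s = w \<or> s = w'")
      case True
      then show ?thesis using Bw Bw' wl by auto
    next
      case False
      then have "s \<in> dom B \<longleftrightarrow> s \<in> dom S" using Bs[of s] by (simp add: domIff)
      then show ?thesis using False by (simp add: S_def)
    qed
    then show ?thesis by blast
  qed
  have nbr_w': "s = w" if nn: "nearest_neighbours w' s" and sl: "s \<in> line \<alpha> k x" for s
  proof -
    obtain \<gamma> where \<gamma>: "s = shift \<gamma> 1 w' \<or> w' = shift \<gamma> 1 s"
      using nn unfolding nearest_neighbours_iff by blast
    have s\<beta>: "s $ \<beta> = x $ \<beta>" by (rule nth_\<beta>[OF sl])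
    have "\<gamma> = \<beta>"
    proof (rule ccontr)
      assume "\<gamma> \<noteq> \<beta>"
      then have "s $ \<beta> = w' $ \<beta>" using \<gamma> by (auto simp: shift_nth)
      then show False using s\<beta> w'\<beta> by simp
    qed
    have "s \<noteq> shift \<beta> 1 w'"
    proof
      assume "s = shift \<beta> 1 w'"
      then have "x $ \<beta> + of_nat 2 = x $ \<beta> + of_nat 0" using s\<beta> w'\<beta> by (simp add: shift_nth)
      then show False using L by (subst (asm) add_of_nat_eq_iff) auto
    qed
    then have "w' = shift \<beta> 1 s" using \<gamma> \<open>\<gamma> = \<beta>\<close> by auto
    then show ?thesis by (simp add: w'_def shift_inj_site)
  qed
  have wpos: "w \<noteq> x" "w \<noteq> u" "w = x' \<longleftrightarrow> i = 1" "w = v \<longleftrightarrow> i = k - 2"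
    using assms L k3 by (auto simp: w_def x'_def u_def v_def)
  have ux: "u $ \<alpha> = x $ \<alpha> + of_nat (k - 1)" by (simp add: u_def shift_nth)
  define GL where "GL = bond x x' (xy b)"
  define GR where "GR = bond u v (xy b')"
  have Bx: "B x = Some (xy b)"
  proof -
    have "S x = Some (xy b)" using L k3 by (simp add: S_def str_first)
    moreover have "x \<noteq> w'" using xl w'l by auto
    ultimately show ?thesis using Bs[of x] wpos(1) by simp
  qed
  have Bu: "B u = Some (xy b')"
  proof -
    have "S u = Some (xy b')" using L k3 by (simp add: S_def u_def str_shift)
    moreover have "u \<noteq> w'" using ul w'l by auto
    ultimately show ?thesis using Bs[of u] wpos(2) by simp
  qed
  have only: "G = T \<or> G = GL \<and> i \<noteq> 1 \<or> G = GR \<and> i \<noteq> k - 2" if "contrib G B \<noteq> 0" for G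
  proof -
    note G = contrib_neq_0D[OF that]
    have end_nbr: "s \<in> line \<alpha> k x" if "nearest_neighbours y s" "B s \<noteq> None" "y \<in> line \<alpha> k x" "y \<noteq> w" for y s
    proof (rule ccontr)
      assume "s \<notin> line \<alpha> k x"
      then have "s = w'" using that(2) domB by auto
      then show False
        using nbr_w'[of y] that nearest_neighbours_commute by blast
    qed
    consider "x \<in> dom (bmul G B)" "u \<in> dom (bmul G B)" | "x \<notin> dom (bmul G B)" | "u \<notin> dom (bmul G B)"
      by blast
    then show ?thesis
    proof cases
      \<comment> \<open>If both ends stay, straightness of the source forces the side site
        \<open>w'\<close> to go, and only the bond \<open>T\<close> can remove it.\<close>
      case 1
      have "w' \<notin> dom (bmul G B)" using straight[OF G(3) 1 ux] w'l by simp
      have "w' \<in> dom B" using domB by simp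
      from removal[OF G(1,2) this \<open>w' \<notin> dom (bmul G B)\<close>] obtain s W where
        s: "nearest_neighbours w' s" "G = bond w' s W" "B w' = Some W" "B s \<noteq> None" by metis
      have "s \<noteq> w'" using s(1) nearest_neighbours_irrefl by blast
      then have "s \<in> line \<alpha> k x" using s(4) domB by auto
      then have "s = w" by (rule nbr_w'[OF s(1)])
      then show ?thesis using s Bw' by (simp add: T bond_commute)
    next
      case 2
      have "x \<in> dom B" using xl domB by simp
      from removal[OF G(1,2) this 2] obtain s W where
        s: "nearest_neighbours x s" "G = bond x s W" "B x = Some W" "B s \<noteq> None" "B s \<noteq> Some W"
        by metis
      have W: "W = xy b" using s(3) Bx by simp
      obtain j where j: "j < k" "s = shift \<alpha> j x"
        using end_nbr[OF s(1,4) xl] wpos(1) by (auto simp: line_def)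
      have "j = 1"
        using nearest_neighbours_on_line[of \<alpha> 0 x j] s(1) j L by simp
      then have sx: "s = x'" using j by (simp add: x'_def)
      moreover have "i \<noteq> 1"
      proof
        assume "i = 1"
        then show False using s(5) left sx wpos(3) Bw W by auto
      qed
      ultimately show ?thesis using s(2) W by (simp add: GL_def)
    next
      case 3
      have "u \<in> dom B" using ul domB by simp
      from removal[OF G(1,2) this 3] obtain s W where
        s: "nearest_neighbours u s" "G = bond u s W" "B u = Some W" "B s \<noteq> None" "B s \<noteq> Some W"
        by metis
      have W: "W = xy b'" using s(3) Bu by simp
      obtain j where j: "j < k" "s = shift \<alpha> j x"
        using end_nbr[OF s(1,4) ul] wpos(2) by (auto simp: line_def)
      have "j = k - 2"
        using nearest_neighbours_on_line[of \<alpha> "k - 1" x j] s(1) j L k3 by (auto simp: u_def)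
      then have su: "s = v" using j by (simp add: v_def)
      moreover have "i \<noteq> k - 2"
      proof
        assume "i = k - 2"
        then show False using s(5) right su wpos(4) Bw W by auto
      qed
      ultimately show ?thesis using s(2) W by (simp add: GR_def)
    qed
  qed
  have xx': "x \<noteq> x'" and uv: "u \<noteq> v" and xu: "x \<noteq> u" and xv: "x \<noteq> v"
    using L k3 by (auto simp: x'_def u_def v_def)
  have x'l: "x' \<in> line \<alpha> k x" and vl: "v \<in> line \<alpha> k x" using L k3 by (simp_all add: x'_def v_def)
  have "GL \<noteq> GR"
    unfolding GL_def GR_def by (subst bond_eq_iff[OF uv]) (use xu xv in auto)
  moreover have "T \<noteq> GL" "T \<noteq> GR"
    unfolding T GL_def GR_def
    by (subst bond_eq_iff[OF xx'], use wl w'l xl x'l in auto)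
      (subst (asm) bond_eq_iff[OF uv], use wl w'l ul vl in auto)
  \<comment> \<open>\<open>B\<close> has full width along \<alpha> but is not straight.\<close>
  moreover have "q B = 0"
  proof (rule ccontr)
    assume "q B \<noteq> 0"
    from straight[OF this _ _ ux] domB xl ul have "dom B = line \<alpha> k x" by simp
    then show False using domB w'l by auto
  qed
  moreover have "\<mu> * q B = (\<Sum>G\<in>{T, GL, GR}. contrib G B)"
    by (rule coeff_eq_sum) (use only in blast)
  ultimately have sum0: "contrib T B + contrib GL B + contrib GR B = 0"
    by (simp add: add.assoc)
  have cT: "contrib T B = 2 * \<i> * sJ t * q S"
  proof -
    have "nearest_neighbours w w'" by (simp add: w'_def)
    moreover have "kappa T S = - 2 * \<i> * sgb t"
      unfolding T kappa_bond[OF ww'] Sw Sw' by simp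
    moreover have "bmul T B = S" by (simp add: B_def)
    ultimately show ?thesis by (simp add: contrib_def hc_bond T sJ_def)
  qed
  have cL: "contrib GL B = - 2 * \<i> * sJ b * (if i = 1 then 0 else q (bmul T (str \<alpha> (k - 1) x' (\<not> b) b')))"
  proof (cases "i = 1")
    case True
    then show ?thesis using only[of GL] \<open>GL \<noteq> GR\<close> \<open>T \<noteq> GL\<close> by (cases "contrib GL B = 0") auto
  next
    case False
    let ?A = "bmul GL B"
    have A: "?A = bmul T (str \<alpha> (k - 1) x' (\<not> b) b')"
    proof -
      \<comment> \<open>Modulo phases bonds commute: the attached bond can be applied after the
        truncation of the string.\<close>
      have "?A = bmul T (bmul GL S)" unfolding B_def by (rule bmul_left_commute)
      also have "bmul GL S = str \<alpha> (k - 1) x' (\<not> b) b'"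
        unfolding GL_def S_def x'_def using k3 k_le by (intro bond_str_left) auto
      finally show ?thesis .
    qed
    have "nearest_neighbours x x'" by (simp add: x'_def)
    moreover have "kappa GL ?A = 2 * \<i> * sgb b"
      unfolding GL_def
    proof (rule kappa_remove[OF _ _ xx'])
      show "bmul (bond x x' (xy b)) B x = None" by (simp add: bmul_apply bond_apply Bx)
      have "str \<alpha> (k - 1) x' (\<not> b) b' x' = Some (xy (\<not> b))"
        using L k3 by (intro str_first) auto
      moreover have "x' \<noteq> w" "x' \<noteq> w'" using False wpos(3) x'l w'l by auto
      then have "bmul T (str \<alpha> (k - 1) x' (\<not> b) b') x' = str \<alpha> (k - 1) x' (\<not> b) b' x'"
        by (simp add: T bmul_apply bond_apply)
      ultimately show "bmul (bond x x' (xy b)) B x' = Some (xy (\<not> b))"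
        using A unfolding GL_def by (simp only:)
    qed
    ultimately show ?thesis using False by (simp add: contrib_def hc_bond GL_def sJ_def A[unfolded GL_def])
  qed
  have cR: "contrib GR B = - 2 * \<i> * sJ b' * (if i = k - 2 then 0 else q (bmul T (str \<alpha> (k - 1) x b (\<not> b'))))"
  proof (cases "i = k - 2")
    case True
    then show ?thesis using only[of GR] \<open>GL \<noteq> GR\<close> \<open>T \<noteq> GR\<close> by (cases "contrib GR B = 0") auto
  next
    case False
    let ?A = "bmul GR B"
    have A: "?A = bmul T (str \<alpha> (k - 1) x b (\<not> b'))"
    proof -
      have "?A = bmul T (bmul GR S)" unfolding B_def by (rule bmul_left_commute)
      also have "bmul GR S = str \<alpha> (k - 1) x b (\<not> b')"
        unfolding GR_def S_def u_def v_def using k3 k_le by (intro bond_str_right) auto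
      finally show ?thesis .
    qed
    have "nearest_neighbours u v"
    proof -
      have "k - 2 + 1 = k - 1" using k3 by simp
      then have "u = shift \<alpha> 1 v" unfolding u_def v_def shift_shift by simp
      then show ?thesis by simp
    qed
    moreover have "kappa GR ?A = 2 * \<i> * sgb b'"
      unfolding GR_def
    proof (rule kappa_remove[OF _ _ uv])
      show "bmul (bond u v (xy b')) B u = None" by (simp add: bmul_apply bond_apply Bu)
      have "str \<alpha> (k - 1) x b (\<not> b') v = Some (xy (\<not> b'))"
        using L k3 by (simp add: v_def str_shift numeral_2_eq_2)
      moreover have "v \<noteq> w" "v \<noteq> w'" using False wpos(4) vl w'l by auto
      then have "bmul T (str \<alpha> (k - 1) x b (\<not> b')) v = str \<alpha> (k - 1) x b (\<not> b') v"
        by (simp add: T bmul_apply bond_apply)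
      ultimately show "bmul (bond u v (xy b')) B v = Some (xy (\<not> b'))"
        using A unfolding GR_def by (simp only:)
    qed
    ultimately show ?thesis using False by (simp add: contrib_def hc_bond GR_def sJ_def A[unfolded GR_def])
  qed
  define X where "X = sJ b * (if i = 1 then 0 else q (bmul T (str \<alpha> (k - 1) x' (\<not> b) b')))"
  define Y where "Y = sJ b' * (if i = k - 2 then 0 else q (bmul T (str \<alpha> (k - 1) x b (\<not> b'))))"
  have "2 * \<i> * (sJ t * q S - (X + Y)) = contrib T B + contrib GL B + contrib GR B"
  proof -
    have "contrib GL B = - 2 * \<i> * X" "contrib GR B = - 2 * \<i> * Y"
      unfolding cL cR X_def Y_def by (simp_all only: mult.assoc)
    then show ?thesis by (simp add: cT algebra_simps)
  qed
  then have "sJ t * q S - (X + Y) = 0" unfolding sum0 by simp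
  then show ?thesis unfolding S_def x'_def X_def Y_def by (simp only: right_minus_eq)
qed

text \<open>The bond \<open>T\<close> stays fixed while the string slides past it, \<open>n\<close>
  running from 0 to \<open>k - 3\<close>. The left truncation at \<open>n\<close> is the right
  truncation at \<open>Suc n\<close>, so the equations telescope.\<close>

lemma improper_zero_long:
  assumes "\<beta> \<noteq> \<alpha>" "3 \<le> k" "\<not> proper k b b'"
  shows "q (str \<alpha> k x b b') = 0"
proof (rule ccontr)
  assume nz: "q (str \<alpha> k x b b') \<noteq> 0"
  \<comment> \<open>With this letter the right truncation drops out at \<open>n = 0\<close>;
    improper parity makes the left truncation drop out at \<open>n = k - 3\<close>. These are the
    zero values of \<open>P\<close> at 0 and \<open>k - 2\<close>.\<close>
  define t where "t = (\<not> b')"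
  define w where "w = shift \<alpha> (k - 2) x"
  define T where "T = bond w (shift \<beta> 1 w) (xy t)"
  define Q where "Q = (\<lambda>n. q (str \<alpha> k (shift \<alpha> n x) (b = even n) (b' = even n)))"
  define P where "P = (\<lambda>n. if n = 0 \<or> n = k - 2 then 0 else
      q (bmul T (str \<alpha> (k - 1) (shift \<alpha> n x) (b = even n) (\<not> (b' = even n)))))"
  define \<sigma> where "\<sigma> = (\<lambda>n::nat. sJ (b = even n))"
  define \<tau> where "\<tau> = (\<lambda>n::nat. sJ (b' = even n))"
  have "of_nat (k - 2) * sJ t * Q 0 = \<tau> 0 * P 0 - telescoping_factor \<sigma> \<tau> (k - 2) * \<tau> (k - 2) * P (k - 2)"
  proof (rule telescoping)
    fix n assume n: "n < k - 2"
    have w: "shift \<alpha> (k - 2 - n) (shift \<alpha> n x) = w" using n by (simp add: w_def)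
    have "sJ t * Q n = \<sigma> n * (if k - 2 - n = 1 then 0 else
        q (bmul T (str \<alpha> (k - 1) (shift \<alpha> 1 (shift \<alpha> n x)) (\<not> (b = even n)) (b' = even n))))
      + \<tau> n * (if k - 2 - n = k - 2 then 0 else
        q (bmul T (str \<alpha> (k - 1) (shift \<alpha> n x) (b = even n) (\<not> (b' = even n)))))"
      unfolding Q_def \<sigma>_def \<tau>_def T_def w[symmetric]
    proof (rule T_equation[OF assms(1)])
      assume "k - 2 - n = 1"
      then have "k = n + 3" by simp
      then show "(b = even n) = (\<not> t)"
        using assms(3) by (auto simp: proper_def t_def)
    next
      assume "k - 2 - n = k - 2"
      then have "n = 0" using n by simp
      then show "(b' = even n) = (\<not> t)" by (simp add: t_def)
    qed (use n in auto)
    moreover have "k - 2 - n = 1 \<longleftrightarrow> Suc n = 0 \<or> Suc n = k - 2" "k - 2 - n = k - 2 \<longleftrightarrow> n = 0 \<or> n = k - 2"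
      using n by auto
    moreover have "(\<not> (b = even n)) = (b = even (Suc n))" "(b' = even n) = (\<not> (b' = even (Suc n)))"
      by auto
    moreover have "shift \<alpha> 1 (shift \<alpha> n x) = shift \<alpha> (Suc n) x" by simp
    ultimately show "sJ t * Q n = \<sigma> n * P (Suc n) + \<tau> n * P n"
      unfolding P_def by (simp only:)
  next
    fix n
    show "\<sigma> n * Q (Suc n) = - \<tau> (Suc n) * Q n"
      unfolding \<sigma>_def \<tau>_def Q_def by (rule string_shift_iterated(2)[OF nz])
  qed (simp add: \<tau>_def sJ_neq_0)
  also have "\<dots> = 0" by (simp add: P_def)
  finally have "of_nat (k - 2) * sJ t * Q 0 = 0" .
  moreover have "k - 2 \<noteq> 0" using assms(2) by simp
  then have "(of_nat (k - 2) :: complex) \<noteq> 0" by (simp only: of_nat_eq_0_iff not_False_eq_True)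
  moreover have "Q 0 \<noteq> 0" using nz by (simp add: Q_def)
  ultimately show False using sJ_neq_0 by simp
qed

text \<open>For \<open>k = 2\<close> the coefficient at \<open>x y\<close> changes sign when \<open>x\<close> is replaced by another neighbour
  of \<open>y\<close>. In dimension at least two there are three of them, so the coefficient vanishes.\<close>

lemma improper_pair:
  assumes "k = 2" "nearest_neighbours x y" "nearest_neighbours z y" "x \<noteq> z" "\<not> nearest_neighbours x z"
    and apart: "\<And>A. x \<in> dom A \<Longrightarrow> z \<in> dom A \<Longrightarrow> q A = 0"
  shows "q [x \<mapsto> xy b, y \<mapsto> xy (\<not> b)] + q [z \<mapsto> xy b, y \<mapsto> xy (\<not> b)] = 0"
proof -
  define Ax where "Ax = [x \<mapsto> xy b, y \<mapsto> xy (\<not> b)]"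
  define Az where "Az = [z \<mapsto> xy b, y \<mapsto> xy (\<not> b)]"
  \<comment> \<open>This three-site product arises from \<open>Ax\<close> through the bond at
    \<open>z\<close> and from \<open>Az\<close> through the bond at \<open>x\<close>.\<close>
  define B where "B = [x \<mapsto> xy b, y \<mapsto> PZ, z \<mapsto> xy b]"
  define Gx where "Gx = bond x y (xy b)"
  define Gz where "Gz = bond z y (xy b)"
  have xy: "x \<noteq> y" and zy: "z \<noteq> y" using assms nearest_neighbours_irrefl by auto
  have Bv: "B x = Some (xy b)" "B y = Some PZ" "B z = Some (xy b)" "dom B = {x, y, z}"
    using xy zy assms(4) by (auto simp: B_def)
  have AA: "bmul Gx B = Az" "bmul Gz B = Ax"
    using xy zy assms(4) by (auto simp: fun_eq_iff bmul_apply Gx_def Gz_def bond_apply B_def Ax_def Az_def)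
  have only: "G = Gx \<or> G = Gz" if "contrib G B \<noteq> 0" for G
  proof -
    note G = contrib_neq_0D[OF that]
    consider "x \<notin> dom (bmul G B)" | "z \<notin> dom (bmul G B)" using apart G(3) by blast
    then show ?thesis
    proof cases
      case 1
      have "x \<in> dom B" using Bv by simp
      from removal[OF G(1,2) this 1] obtain s W where
        s: "nearest_neighbours x s" "G = bond x s W" "B x = Some W" "B s \<noteq> None" by metis
      have "s \<in> {x, y, z}" using s(4) Bv(4) by auto
      then have "s = y" using s(1) assms(5) nearest_neighbours_irrefl by blast
      then show ?thesis using s Bv by (simp add: Gx_def)
    next
      case 2
      have "z \<in> dom B" using Bv by simp
      from removal[OF G(1,2) this 2] obtain s W where
        s: "nearest_neighbours z s" "G = bond z s W" "B z = Some W" "B s \<noteq> None" by metis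
      have "s \<in> {x, y, z}" using s(4) Bv(4) by auto
      then have "s = y" using s(1) assms(5) nearest_neighbours_irrefl nearest_neighbours_commute by blast
      then show ?thesis using s Bv by (simp add: Gz_def)
    qed
  qed
  have "Gx \<noteq> Gz" unfolding Gx_def Gz_def by (subst bond_eq_iff[OF zy]) (use assms(4) xy in auto)
  moreover have "q B = 0" by (rule apart) (use Bv in auto)
  moreover have "\<mu> * q B = (\<Sum>G\<in>{Gx, Gz}. contrib G B)"
    by (rule coeff_eq_sum) (use only in blast)
  ultimately have "contrib Gx B + contrib Gz B = 0" by simp
  moreover have "kappa Gx Az = 2 * \<i> * sgb b"
    unfolding Gx_def by (rule kappa_remove[OF _ _ xy]) (use xy zy assms(4) in \<open>auto simp: Az_def\<close>)
  then have "contrib Gx B = - 2 * \<i> * sJ b * q Az"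
    using assms(2) by (simp add: contrib_def AA) (simp add: Gx_def hc_bond sJ_def)
  moreover have "kappa Gz Ax = 2 * \<i> * sgb b"
    unfolding Gz_def by (rule kappa_remove[OF _ _ zy]) (use xy zy assms(4) in \<open>auto simp: Ax_def\<close>)
  then have "contrib Gz B = - 2 * \<i> * sJ b * q Ax"
    using assms(3) by (simp add: contrib_def AA) (simp add: Gz_def hc_bond sJ_def)
  ultimately have "- 2 * \<i> * sJ b * (q Ax + q Az) = 0" by (simp add: algebra_simps)
  then show ?thesis using sJ_neq_0 by (simp add: Ax_def Az_def)
qed

lemma improper_zero_short:
  assumes "\<beta> \<noteq> \<alpha>" "k = 2" "\<not> proper k b b'"
  shows "q (str \<alpha> k x b b') = 0"
proof -
  note L = card_gt
  \<comment> \<open>The three neighbours of \<open>y\<close> are \<open>x\<close> and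
    \<open>z\<close> along \<alpha>, and \<open>w\<close> along \<beta>.\<close>
  define y where "y = shift \<alpha> 1 x"
  define z where "z = shift \<alpha> 1 y"
  define w where "w = shift \<beta> 1 y"
  have b': "b' = (\<not> b)" using assms by (auto simp: proper_def)
  have xy: "x \<noteq> y" using L by (simp add: y_def)
  have z2: "z = shift \<alpha> 2 x" by (simp add: z_def y_def numeral_2_eq_2)
  have "line \<alpha> k x = {x, y}"
    by (auto simp: line_def assms(2) y_def numeral_2_eq_2 lessThan_Suc)
  then have str: "str \<alpha> k x b b' = [x \<mapsto> xy b, y \<mapsto> xy (\<not> b)]"
    using xy assms(2) L by (intro str_eqI[symmetric]) (auto simp: b' y_def)
  have coords: "y $ \<alpha> = x $ \<alpha> + 1" "z $ \<alpha> = x $ \<alpha> + 2" "w $ \<alpha> = x $ \<alpha> + 1"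
    "y $ \<beta> = x $ \<beta>" "z $ \<beta> = x $ \<beta>" "w $ \<beta> = x $ \<beta> + 1"
    using assms(1) by (simp_all add: z_def w_def y_def shift_nth)
  have nn: "nearest_neighbours x y" "nearest_neighbours z y" "nearest_neighbours w y"
    by (simp add: y_def, simp add: z_def, simp add: w_def)
  have distinct: "x \<noteq> w" "z \<noteq> w" using coords by auto
  have "x \<noteq> z" unfolding z2 using L by simp
  have not_nn: "\<not> nearest_neighbours x w" "\<not> nearest_neighbours z w"
  proof -
    have *: False if nn: "nearest_neighbours s w" and "s $ \<alpha> \<noteq> w $ \<alpha>" "s $ \<beta> = x $ \<beta>" for s
    proof -
      obtain \<gamma> where \<gamma>: "w = shift \<gamma> 1 s \<or> s = shift \<gamma> 1 w"
        using nn unfolding nearest_neighbours_iff by blast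
      then have "\<gamma> = \<alpha>" using that(2) by (auto simp: shift_nth split: if_splits)
      then have "s $ \<beta> = w $ \<beta>" using \<gamma> assms(1) by (auto simp: shift_nth)
      then show False using that(3) coords by simp
    qed
    show "\<not> nearest_neighbours x w" using *[of x] coords by auto
    have "z $ \<alpha> = w $ \<alpha> + 1" using coords by (simp add: add.assoc)
    then show "\<not> nearest_neighbours z w" using *[of z] coords(5) by auto
  qed
  have "\<not> nearest_neighbours x z"
    using nearest_neighbours_on_line[of \<alpha> 0 x 2] L unfolding z2 by auto
  have k1: "(of_nat (k - 1) :: 'l mod_ring) = 1" using assms(2) by simp
  have line: "line \<alpha> k s = {s, shift \<alpha> 1 s}" for s
    by (auto simp: line_def assms(2) numeral_2_eq_2 lessThan_Suc)
  have xz: "q A = 0" if "x \<in> dom A" "z \<in> dom A" for A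
    using not_too_wide[of A x z \<alpha>] that coords assms(2) by auto
  \<comment> \<open>Such a product has full width 2 along \<alpha>, but a segment in that direction
    contains at most one of \<open>x\<close> and \<open>w\<close>.\<close>
  have xw: "q A = 0" if "x \<in> dom A" "w \<in> dom A" for A
  proof (rule ccontr)
    assume "q A \<noteq> 0"
    from straight[OF this that, of \<alpha>] coords k1 have "dom A = {x, shift \<alpha> 1 x}"
      unfolding line by simp
    then have "w \<in> {x, y}" using that by (simp add: y_def)
    then show False using coords by auto
  qed
  have zw: "q A = 0" if "z \<in> dom A" "w \<in> dom A" for A
  proof (rule ccontr)
    assume "q A \<noteq> 0"
    from straight[OF this that(2,1), of \<alpha>] coords k1 have "dom A = {w, shift \<alpha> 1 w}"
      unfolding line by (simp add: add.assoc)
    then have "z \<in> {w, shift \<alpha> 1 w}" using that by simp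
    then have "z $ \<beta> = w $ \<beta>" using assms(1) by (auto simp: shift_nth)
    then show False using coords by simp
  qed
  define f where "f = (\<lambda>s. q [s \<mapsto> xy b, y \<mapsto> xy (\<not> b)])"
  have xz0: "f x + f z = 0" unfolding f_def
    by (rule improper_pair[OF assms(2) nn(1,2) \<open>x \<noteq> z\<close> \<open>\<not> nearest_neighbours x z\<close> xz])
  have xw0: "f x + f w = 0" unfolding f_def
    by (rule improper_pair[OF assms(2) nn(1,3) distinct(1) not_nn(1) xw])
  have zw0: "f z + f w = 0" unfolding f_def
    by (rule improper_pair[OF assms(2) nn(2,3) distinct(2) not_nn(2) zw])
  have "2 * f x = (f x + f z) + (f x + f w) - (f z + f w)" by simp
  also have "\<dots> = 0" unfolding xz0 xw0 zw0 by simp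
  finally have "f x = 0" by simp
  then show ?thesis by (simp add: f_def str)
qed

section \<open>Strings of proper parity\<close>

text \<open>The normal form has the same \<open>chi\<close>, and its parity must be proper because
  improper strings have coefficient zero.\<close>

lemma chi_straight:
  assumes "\<beta> \<noteq> \<alpha>" "q A \<noteq> 0" "dom A = line \<alpha> k x"
  shows "chi P A = 1"
proof -
  obtain y b b' where y: "q (str \<alpha> k y b b') \<noteq> 0" "\<And>P. chi P (str \<alpha> k y b b') = chi P A"
    using normal_form[OF assms(2,3)] by blast
  have "proper k b b'"
    using improper_zero_long[OF assms(1)] improper_zero_short[OF assms(1)] y(1) k_ge_2
    by (cases "k = 2") auto
  then have "chi P (str \<alpha> k y b b') = 1" using k_ge_2 k_le by (intro chi_str) auto
  then show ?thesis using y(2) by simp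
qed

text \<open>If both ends stay, the source is straight and has \<open>chi\<close> equal to 1, which
  excludes fields, while a bond that keeps the support commutes. If an end goes,
  \<open>removal\<close> leaves only the end bond; for \<open>k = 2\<close> even this is impossible,
  as both ends carry the same letter.\<close>

lemma proper_only_ends:
  assumes "\<beta> \<noteq> \<alpha>" "proper k b b'" "contrib G (str \<alpha> k x b b') \<noteq> 0"
  defines "u \<equiv> shift \<alpha> (k - 1) x" and "v \<equiv> shift \<alpha> (k - 2) x"
  shows "3 \<le> k \<and> (G = bond x (shift \<alpha> 1 x) (xy b) \<or> G = bond u v (xy b'))"
proof -
  note L = card_gt k_ge_2
  define S where "S = str \<alpha> k x b b'"
  note G = contrib_neq_0D[OF assms(3), folded S_def]
  have ux: "u $ \<alpha> = x $ \<alpha> + of_nat (k - 1)" by (simp add: u_def shift_nth)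
  have xl: "x \<in> dom S" using shift_in_line[of 0 k \<alpha> x] L by (simp add: S_def)
  have ul: "u \<in> dom S" using L by (simp add: S_def u_def)
  have Sx: "S x = Some (xy b)" and Su: "S u = Some (xy b')"
    using L by (simp_all add: S_def u_def str_first str_shift)
  have bb: "b = b'" if "k = 2" using assms(2) that by (simp add: proper_def)
  consider "x \<in> dom (bmul G S)" "u \<in> dom (bmul G S)" | "x \<notin> dom (bmul G S)" | "u \<notin> dom (bmul G S)"
    by blast
  then show ?thesis
  proof cases
    case 1
    have dA: "dom (bmul G S) = line \<alpha> k x" by (rule straight[OF G(3) 1 ux])
    from hc_cases[OF G(1)] show ?thesis
    proof (elim disjE exE conjE)
      fix s P assume Gs: "G = [s \<mapsto> P]"
      \<comment> \<open>The field term \<open>P\<close> has character -1 with respect to any other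
        letter, whereas the string and the source have character 1.\<close>
      obtain P' where "P' \<noteq> P" by (metis pauli.distinct(1))
      have "chi P' (bmul G S) = 1" by (rule chi_straight[OF assms(1) G(3) dA])
      moreover have "chi P' S = 1"
        unfolding S_def using assms(2) k_ge_2 k_le by (intro chi_str) auto
      ultimately show ?thesis using \<open>P' \<noteq> P\<close> by (simp add: chi_bmul Gs chi_site)
    next
      fix s t W assume st: "nearest_neighbours s t" "G = bond s t W"
      then show ?thesis
        using dom_bmul_bond[of s t W S] nearest_neighbours_irrefl[OF st(1)] G(2) dA
        by (simp add: S_def)
    qed
  next
    case 2
    from removal[OF G(1,2) xl 2] obtain s W where
      s: "nearest_neighbours x s" "G = bond x s W" "S x = Some W" "S s \<noteq> None" "S s \<noteq> Some W"
      by metis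
    have "s \<in> dom S" using s(4) by auto
    then obtain j where j: "j < k" "s = shift \<alpha> j x" by (auto simp: S_def line_def)
    have j1: "j = 1"
      using nearest_neighbours_on_line[of \<alpha> 0 x j] s(1) j L by simp
    have "k \<noteq> 2"
    proof
      assume "k = 2"
      then have "s = u" using j j1 by (simp add: u_def)
      then show False using s(3,5) Sx Su bb[OF \<open>k = 2\<close>] by simp
    qed
    then show ?thesis using s(2,3) Sx j j1 k_ge_2 by simp
  next
    case 3
    from removal[OF G(1,2) ul 3] obtain s W where
      s: "nearest_neighbours u s" "G = bond u s W" "S u = Some W" "S s \<noteq> None" "S s \<noteq> Some W"
      by metis
    have "s \<in> dom S" using s(4) by auto
    then obtain j where j: "j < k" "s = shift \<alpha> j x" by (auto simp: S_def line_def)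
    have j1: "j = k - 2"
      using nearest_neighbours_on_line[of \<alpha> "k - 1" x j] s(1) j L by (auto simp: u_def)
    have "k \<noteq> 2"
    proof
      assume "k = 2"
      then have "s = x" using j j1 by simp
      then show False using s(3,5) Sx Su bb[OF \<open>k = 2\<close>] by simp
    qed
    then show ?thesis using s(2,3) Su j j1 k_ge_2 by (simp add: v_def)
  qed
qed

text \<open>Only the two end bonds contribute, and their sources are the two truncations. Each
  commutator gives \<open>2 * \<i>\<close> times a sign, and the bond coefficient gives the minus
  sign.\<close>

lemma proper_equation:
  assumes "\<beta> \<noteq> \<alpha>" "proper k b b'" "3 \<le> k"
  shows "\<mu> * q (str \<alpha> k x b b') = - 2 * \<i> *
    (sJ b * q (str \<alpha> (k - 1) (shift \<alpha> 1 x) (\<not> b) b') + sJ b' * q (str \<alpha> (k - 1) x b (\<not> b')))"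
proof -
  note L = card_gt
  define S where "S = str \<alpha> k x b b'"
  define x' where "x' = shift \<alpha> 1 x"
  define u where "u = shift \<alpha> (k - 1) x"
  define v where "v = shift \<alpha> (k - 2) x"
  define GL where "GL = bond x x' (xy b)"
  define GR where "GR = bond u v (xy b')"
  have xx': "x \<noteq> x'" and uv: "u \<noteq> v" and xu: "x \<noteq> u" and xv: "x \<noteq> v"
    using L assms(3) by (auto simp: x'_def u_def v_def)
  have "GL \<noteq> GR"
    unfolding GL_def GR_def by (subst bond_eq_iff[OF uv]) (use xu xv in auto)
  moreover have "\<mu> * q S = (\<Sum>G\<in>{GL, GR}. contrib G S)"
    unfolding S_def
    by (rule coeff_eq_sum)
      (use proper_only_ends[OF assms(1,2)] in \<open>auto simp: GL_def GR_def x'_def u_def v_def\<close>)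
  ultimately have "\<mu> * q S = contrib GL S + contrib GR S" by simp
  moreover have "contrib GL S = - 2 * \<i> * sJ b * q (str \<alpha> (k - 1) x' (\<not> b) b')"
  proof -
    have A: "bmul GL S = str \<alpha> (k - 1) x' (\<not> b) b'"
      unfolding GL_def S_def x'_def using assms(3) k_le by (intro bond_str_left) auto
    have "x \<notin> dom (bmul GL S)"
      using L assms(3) by (simp add: in_dom_bmul GL_def S_def bond_apply str_first)
    then have "bmul GL S x = None" by (simp add: domIff)
    moreover have "bmul GL S x' = Some (xy (\<not> b))"
      unfolding A using L assms(3) by (intro str_first) auto
    ultimately have "kappa GL (bmul GL S) = 2 * \<i> * sgb b"
      unfolding GL_def using xx' by (intro kappa_remove)
    moreover have "nearest_neighbours x x'" by (simp add: x'_def)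
    ultimately show ?thesis unfolding contrib_def by (simp add: A) (simp add: GL_def hc_bond sJ_def)
  qed
  moreover have "contrib GR S = - 2 * \<i> * sJ b' * q (str \<alpha> (k - 1) x b (\<not> b'))"
  proof -
    have A: "bmul GR S = str \<alpha> (k - 1) x b (\<not> b')"
      unfolding GR_def S_def u_def v_def using assms(3) k_le by (intro bond_str_right) auto
    have "u \<notin> dom (bmul GR S)"
      using L assms(3) by (simp add: in_dom_bmul GR_def S_def bond_apply u_def str_shift)
    then have "bmul GR S u = None" by (simp add: domIff)
    moreover have "bmul GR S v = Some (xy (\<not> b'))"
      unfolding A using L assms(3) by (simp add: v_def str_shift numeral_2_eq_2)
    ultimately have "kappa GR (bmul GR S) = 2 * \<i> * sgb b'"
      unfolding GR_def using uv by (intro kappa_remove)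
    moreover have "nearest_neighbours u v"
    proof -
      have "k - 2 + 1 = k - 1" using assms(3) by simp
      then have "u = shift \<alpha> 1 v" unfolding u_def v_def shift_shift by simp
      then show ?thesis by simp
    qed
    ultimately show ?thesis unfolding contrib_def by (simp add: A) (simp add: GR_def hc_bond sJ_def)
  qed
  ultimately show ?thesis by (simp add: S_def x'_def algebra_simps)
qed

lemma proper_zero:
  assumes "\<beta> \<noteq> \<alpha>" "proper k b b'" "\<mu> \<noteq> 0"
  shows "q (str \<alpha> k x b b') = 0"
proof (cases "k = 2")
  case True
  \<comment> \<open>For \<open>k = 2\<close> no term contributes at all.\<close>
  have "\<mu> * q (str \<alpha> k x b b') = (\<Sum>G\<in>{}. contrib G (str \<alpha> k x b b'))"
    by (rule coeff_eq_sum) (use proper_only_ends[OF assms(1,2)] True in auto)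
  then show ?thesis using assms(3) by simp
next
  case False
  then have k3: "3 \<le> k" using k_ge_2 by simp
  show ?thesis
  proof (rule ccontr)
    assume nz: "q (str \<alpha> k x b b') \<noteq> 0"
    define Q where "Q = (\<lambda>n. q (str \<alpha> k (shift \<alpha> n x) (b = even n) (b' = even n)))"
    define P where "P = (\<lambda>n. q (str \<alpha> (k - 1) (shift \<alpha> n x) (b = even n) (\<not> (b' = even n))))"
    define \<sigma> where "\<sigma> = (\<lambda>n::nat. sJ (b = even n))"
    define \<tau> where "\<tau> = (\<lambda>n::nat. sJ (b' = even n))"
    define m where "m = \<mu> / (- 2 * \<i>)"
    \<comment> \<open>Going round the torus twice makes the number of letter flips even, so the
      string returns to itself also for odd side length.\<close>
    define N where "N = 2 * CARD('l)"
    have \<tau>_nz: "\<tau> n \<noteq> 0" for n by (simp add: \<tau>_def sJ_neq_0)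
    have "of_nat N * m * Q 0 = \<tau> 0 * P 0 - telescoping_factor \<sigma> \<tau> N * \<tau> N * P N"
    proof (rule telescoping)
      fix n :: nat
      have "proper k (b = even n) (b' = even n)" using assms(2) by (auto simp: proper_def)
      from proper_equation[OF assms(1) this k3, of "shift \<alpha> n x"]
      have "\<mu> * Q n = - 2 * \<i> * (\<sigma> n * q (str \<alpha> (k - 1) (shift \<alpha> 1 (shift \<alpha> n x)) (\<not> (b = even n)) (b' = even n))
         + \<tau> n * P n)"
        by (simp only: Q_def P_def \<sigma>_def \<tau>_def)
      also have "q (str \<alpha> (k - 1) (shift \<alpha> 1 (shift \<alpha> n x)) (\<not> (b = even n)) (b' = even n)) = P (Suc n)"
      proof -
        have "(\<not> (b = even n)) = (b = even (Suc n))" "(b' = even n) = (\<not> (b' = even (Suc n)))" by auto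
        moreover have "shift \<alpha> 1 (shift \<alpha> n x) = shift \<alpha> (Suc n) x" by simp
        ultimately show ?thesis unfolding P_def by (simp only:)
      qed
      finally have *: "\<mu> * Q n = - 2 * \<i> * (\<sigma> n * P (Suc n) + \<tau> n * P n)" .
      have "m * Q n = \<mu> * Q n / (- 2 * \<i>)" by (simp add: m_def)
      then show "m * Q n = \<sigma> n * P (Suc n) + \<tau> n * P n" unfolding * by simp
    next
      fix n show "\<sigma> n * Q (Suc n) = - \<tau> (Suc n) * Q n"
        unfolding \<sigma>_def \<tau>_def Q_def by (rule string_shift_iterated(2)[OF nz])
    qed (rule \<tau>_nz)
    also have "telescoping_factor \<sigma> \<tau> N = 1"
    proof -
      have "telescoping_factor \<sigma> \<tau> (2 * j) = 1" for j
      proof (induction j)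
        case (Suc j)
        \<comment> \<open>Over two steps each end takes both letters once, so both products equal
          \<open>sJ True * sJ False\<close> and the factor returns to its value.\<close>
        have "\<sigma> (2 * j) * \<sigma> (Suc (2 * j)) = \<tau> (Suc (Suc (2 * j))) * \<tau> (Suc (2 * j))"
          by (cases b; cases b') (simp_all add: \<sigma>_def \<tau>_def)
        then show ?case using Suc \<tau>_nz[of "Suc (2 * j)"] \<tau>_nz[of "Suc (Suc (2 * j))"]
          by (simp add: field_simps)
      qed simp
      then show ?thesis by (simp add: N_def)
    qed
    also have "\<tau> N = \<tau> 0" by (simp add: \<tau>_def N_def)
    also have "P N = P 0"
    proof -
      have "shift \<alpha> N x = x"
        unfolding N_def mult_2 shift_shift[symmetric] shift_CARD by (rule refl)
      then show ?thesis by (simp add: P_def N_def)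
    qed
    \<comment> \<open>The two boundary terms coincide and cancel.\<close>
    finally have "of_nat N * m * Q 0 = 0" by simp
    then show False using nz assms(3) by (simp add: m_def N_def Q_def)
  qed
qed

text \<open>Dimension at least two supplies the direction \<beta> for attaching side bonds. A
  nonzero coefficient would pass to a string in normal form, and both parities are excluded.\<close>

lemma no_eigenoperator:
  assumes "\<mu> \<noteq> 0" "2 \<le> CARD('d)" "coord_width \<alpha> (dom A) = k"
  shows "q A = 0"
proof (rule ccontr)
  assume nz: "q A \<noteq> 0"
  have "(UNIV :: 'd set) \<noteq> {\<alpha>}"
  proof
    assume "(UNIV :: 'd set) = {\<alpha>}"
    then have "CARD('d) = card {\<alpha>}" by (rule arg_cong)
    then show False using assms(2) by simp
  qed
  then obtain \<beta> where \<beta>: "\<beta> \<noteq> \<alpha>" by blast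
  obtain x u where "x \<in> dom A" "u \<in> dom A" "u $ \<alpha> = x $ \<alpha> + of_nat (k - 1)"
    using coord_width_ends[OF assms(3) k_ge_2] by blast
  then have "dom A = line \<alpha> k x" by (rule straight[OF nz])
  from nz this obtain y b b' where "q (str \<alpha> k y b b') \<noteq> 0" by (rule normal_form)
  then show False
    using proper_zero[OF \<beta> _ assms(1)] improper_zero_long[OF \<beta>] improper_zero_short[OF \<beta>] k_ge_2
    by (cases "proper k b b'"; cases "k = 2") auto
qed

end

theorem propositionA3:
  fixes J\<^sub>X J\<^sub>Y J\<^sub>Z h\<^sub>X h\<^sub>Y h\<^sub>Z :: real
    and kmax :: nat
    and q :: "(('l::nontriv, 'd::finite) site \<rightharpoonup> pauli) \<Rightarrow> complex"
    and Q :: "('l, 'd) site operator"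
  assumes "CARD('d) \<ge> 2"
    and "J\<^sub>X \<noteq> 0" and "J\<^sub>Y \<noteq> 0"
    and "2 \<le> kmax" and "real kmax \<le> real CARD('l) / 2"
    and "Q = (\<Sum>A\<in>{A \<in> products. width (dom A) \<le> kmax}. cscale (q A) (product_op A))"
    and "\<exists>A\<in>products. width (dom A) = kmax \<and> q A \<noteq> 0"
  shows "\<not> (\<exists>\<mu>::real. \<mu> \<noteq> 0 \<and>
           commutator (hamiltonian J\<^sub>X J\<^sub>Y J\<^sub>Z h\<^sub>X h\<^sub>Y h\<^sub>Z) Q = \<mu> *\<^sub>R Q)"
proof
  assume "\<exists>\<mu>::real. \<mu> \<noteq> 0 \<and> commutator (hamiltonian J\<^sub>X J\<^sub>Y J\<^sub>Z h\<^sub>X h\<^sub>Y h\<^sub>Z) Q = \<mu> *\<^sub>R Q"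
  then obtain \<mu> :: real where \<mu>: "\<mu> \<noteq> 0"
    "commutator (hamiltonian J\<^sub>X J\<^sub>Y J\<^sub>Z h\<^sub>X h\<^sub>Y h\<^sub>Z) Q = \<mu> *\<^sub>R Q" by blast
  define J where "J = (\<lambda>P. case P of PX \<Rightarrow> J\<^sub>X | PY \<Rightarrow> J\<^sub>Y | PZ \<Rightarrow> J\<^sub>Z)"
  \<comment> \<open>Extension by zero to all partial maps, including the empty one, so that sums run
    over \<open>UNIV\<close>.\<close>
  define q' where "q' = (\<lambda>A. if A \<in> products \<and> width (dom A) \<le> kmax then q A else 0)"
  obtain hc :: "(('l, 'd) site \<rightharpoonup> pauli) \<Rightarrow> complex" where
    H: "hamiltonian J\<^sub>X J\<^sub>Y J\<^sub>Z h\<^sub>X h\<^sub>Y h\<^sub>Z = (\<Sum>G\<in>UNIV. cscale (hc G) (product_op G))"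
    and hc: "\<And>u v W. nearest_neighbours u v \<Longrightarrow> hc (bond u v W) = - of_real (J W)"
      "\<And>G. hc G \<noteq> 0 \<Longrightarrow> (\<exists>u P. G = [u \<mapsto> P]) \<or> (\<exists>u v W. nearest_neighbours u v \<and> G = bond u v W)"
    by (rule hamiltonian_expansion[of J\<^sub>X J\<^sub>Y J\<^sub>Z h\<^sub>X h\<^sub>Y h\<^sub>Z, folded J_def], rule that)
  have Q: "Q = (\<Sum>A\<in>UNIV. cscale (q' A) (product_op A))"
  proof -
    have "(\<Sum>A\<in>UNIV. cscale (q' A) (product_op A)) =
        (\<Sum>A\<in>{A \<in> products. width (dom A) \<le> kmax}. cscale (q' A) (product_op A))"
      by (rule sum.mono_neutral_right) (auto simp: q'_def cscale_def vec_eq_iff)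
    also have "\<dots> = Q" unfolding assms(6) by (rule sum.cong) (auto simp: q'_def)
    finally show ?thesis by simp
  qed
  interpret eigenoperator hc q' "\<lambda>W. of_real (J W)" kmax "of_real \<mu>"
  proof
    show "2 \<le> kmax" by fact
    show "2 * kmax \<le> CARD('l)" using assms(5) by linarith
    show "complex_of_real (J PX) \<noteq> 0" "complex_of_real (J PY) \<noteq> 0"
      using assms(2,3) by (simp_all add: J_def)
    show "\<exists>a. \<forall>s\<in>dom A. cval (s $ \<alpha> - a) < kmax" if "q' A \<noteq> 0" for A \<alpha>
    proof -
      have "coord_width \<alpha> (dom A) \<le> kmax"
        using that coord_width_le_width[of \<alpha> "dom A"] by (auto simp: q'_def split: if_splits)
      then show ?thesis using coord_width_arc[of "dom A" \<alpha>] by (meson less_le_trans)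
    qed
    show "of_real \<mu> * q' B = (\<Sum>G\<in>UNIV. hc G * kappa G (bmul G B) * q' (bmul G B))" for B
    proof (rule commutator_coefficients)
      have "\<mu> *\<^sub>R Q = (\<Sum>A\<in>UNIV. \<mu> *\<^sub>R cscale (q' A) (product_op A))"
        by (simp add: Q scaleR_sum_right)
      also have "\<dots> = (\<Sum>A\<in>UNIV. cscale (of_real \<mu> * q' A) (product_op A))"
        by (simp add: cscale_cscale flip: cscale_of_real)
      finally show "commutator (\<Sum>G\<in>UNIV. cscale (hc G) (product_op G)) (\<Sum>A\<in>UNIV. cscale (q' A) (product_op A))
        = (\<Sum>A\<in>UNIV. cscale (of_real \<mu> * q' A) (product_op A))"
        using \<mu>(2) unfolding H Q by simp
    qed
  qed (use hc in auto)
  obtain A where A: "A \<in> products" "width (dom A) = kmax" "q A \<noteq> 0" using assms(7) by blast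
  \<comment> \<open>The long axis is a direction in which the maximal width is attained.\<close>
  obtain \<alpha> where "coord_width \<alpha> (dom A) = kmax" using width_attained[of "dom A"] A(2) by auto
  then have "q' A = 0" using no_eigenoperator assms(1) \<mu>(1) by simp
  then show False using A by (simp add: q'_def)
qed

end
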